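(* Let $\alpha^+,\lambda^+,\alpha^-,\lambda^->0$, let $f$ be the density of the bilateral Gamma distribution with parameters $(\alpha^+,\lambda^+;\alpha^-,\lambda^-)$, and let $N:=\lceil\alpha^++\alpha^-\rceil-1$. Let $f^{(N)}$ denote the $N$-th derivative of $f$ on $\mathbb{R}\setminus\{0\}$ (with $f^{(0)}=f$). (1) $\lim_{x\downarrow0}f^{(N)}(x)$ is finite if and only if $\alpha^+\in\mathbb{N}=\{1,2,\ldots\}$. (2) If $\alpha^+\notin\mathbb{N}$ and $\alpha^++\alpha^-\notin\mathbb{N}$, then $f^{(N)}(x)\sim\frac{C_1}{x^{\alpha}}$ as $x\downarrow0$, with constants $C_1\neq0$ and $\alpha\in(0,1)$ given by $$\alpha=N+1-\alpha^+-\alpha^-,\qquad C_1=\frac{(\lambda^+)^{\alpha^+}(\lambda^-)^{\alpha^-}\sin(\alpha^+\pi)}{\Gamma(\alpha^++\alpha^--N)\,\sin((\alpha^++\alpha^-)\pi)}.$$ (3) Let $\alpha^+\notin\mathbb{N}$ be such that $\alpha^++\alpha^-\in\mathbb{N}$. Then $f^{(N)}(x)\sim M(x)$ as $x\to0$, where $M$ is a slowly varying function as $x\to0$ satisfying $\lim_{x\to0}M(x)=\infty$. Moreover, $\lim_{x\downarrow0}\big(f^{(N)}(x)-f^{(N)}(-x)\big)=C_2\in\mathbb{R}$, where $$C_2=\frac{(\lambda^+)^{\alpha^+}(\lambda^-)^{\alpha^-}}{2}\Big((-1)^{N+1}\cos(\alpha^+\pi)+\cos(\alpha^-\pi)\B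ig).$$
   Context: For $\alpha,\lambda>0$, $\Gamma(\alpha,\lambda)$ denotes the Gamma distribution with density $\frac{\lambda^\alpha}{\Gamma(\alpha)}x^{\alpha-1}e^{-\lambda x}$ on $(0,\infty)$, where $\Gamma(\cdot)$ with one argument is the Gamma function. The bilateral Gamma distribution with parameters $(\alpha^+,\lambda^+;\alpha^-,\lambda^-)$, all $>0$, is the distribution of $X-Y$ where $X\sim\Gamma(\alpha^+,\lambda^+)$ and $Y\sim\Gamma(\alpha^-,\lambda^-)$ are independent. Its density $f(x)=f(x;\alpha^+,\lambda^+,\alpha^-,\lambda^-)$ is given for $x>0$ by $$f(x)=\frac{(\lambda^+)^{\alpha^+}(\lambda^-)^{\alpha^-}}{(\lambda^++\lambda^-)^{\alpha^-}\Gamma(\alpha^+)\Gamma(\alpha^-)}e^{-\lambda^+x}\int_0^\infty v^{\alpha^--1}\Big(x+\frac{v}{\lambda^++\lambda^-}\Big)^{\alpha^+-1}e^{-v}\,dv,$$ and for $x<0$ by $f(x;\alpha^+,\lambda^+,\alpha^-,\lambda^-)=f(-x;\alpha^-,\lambda^-,\alpha^+,\lambda^+)$. The density is $N$ times continuously differentiable on $\mathbb{R}\setminus\{0\}$. The notation $g\sim h$ means that $g(x)/h(x)\to1$ in the indicated limit. A function $M$ is slowly varying as $x\to0$ if $M(cx)/M(x)\to1$ as $x\to0$ for every $c>0$.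
   Formalization: In (3), lim M(x) = ∞ is replaced by lim M(x) = +∞ when ⌊α⁻⌋ is even and lim M(x) = −∞ when ⌊α⁻⌋ is odd; the original fails e.g. for α⁺ = 1/2, α⁻ = 3/2, λ⁺ = λ⁻ = 1, where f′(x) → −∞ as x ↓ 0. *)

theory Defs
  imports "HOL-Probability.Probability" "HOL-Library.Landau_Symbols"
begin

definition gamma_density :: "real \<Rightarrow> real \<Rightarrow> real \<Rightarrow> real" where
  "gamma_density \<alpha> l x =
     (if 0 < x then l powr \<alpha> / Gamma \<alpha> * x powr (\<alpha> - 1) * exp (- l * x) else 0)"

definition bilateral_gamma_density_pos :: "real \<Rightarrow> real \<Rightarrow> real \<Rightarrow> real \<Rightarrow> real \<Rightarrow> real" where
  "bilateral_gamma_density_pos \<alpha>p lp \<alpha>m lm x =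
     lp powr \<alpha>p * lm powr \<alpha>m / ((lp + lm) powr \<alpha>m * Gamma \<alpha>p * Gamma \<alpha>m) * exp (- lp * x) *
     (LBINT v:{0<..}. v powr (\<alpha>m - 1) * (x + v / (lp + lm)) powr (\<alpha>p - 1) * exp (- v))"

text \<open>The arguments are \<open>\<alpha>\<^sup>+\<close>, \<open>\<lambda>\<^sup>+\<close>, \<open>\<alpha>\<^sup>-\<close>, \<open>\<lambda>\<^sup>-\<close>, in this order. The density is only determined
  on \<open>\<real> - {0}\<close>; its value at \<open>0\<close> is a dummy that does not influence derivatives at other points.\<close>

definition bilateral_gamma_density :: "real \<Rightarrow> real \<Rightarrow> real \<Rightarrow> real \<Rightarrow> real \<Rightarrow> real" where
  "bilateral_gamma_density \<alpha>p lp \<alpha>m lm x =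
     (if 0 < x then bilateral_gamma_density_pos \<alpha>p lp \<alpha>m lm x
      else if x < 0 then bilateral_gamma_density_pos \<alpha>m lm \<alpha>p lp (- x)
      else 0)"

text \<open>The filter \<^term>\<open>at 0\<close> is the punctured two-sided neighbourhood of \<open>0\<close>.\<close>

definition slowly_varying_at_0 :: "(real \<Rightarrow> real) \<Rightarrow> bool" where
  "slowly_varying_at_0 M \<longleftrightarrow> (\<forall>c>0. ((\<lambda>x. M (c * x) / M x) \<longlongrightarrow> 1) (at 0))"

lemma gamma_density_nonneg: "0 < \<alpha> \<Longrightarrow> 0 \<le> gamma_density \<alpha> l x"
  by (auto simp: gamma_density_def intro!: mult_nonneg_nonneg divide_nonneg_nonneg less_imp_le[OF Gamma_real_pos])

lemma measurable_gamma_density [measurable]: "gamma_density \<alpha> l \<in> borel_measurable borel"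
  unfolding gamma_density_def by measurable

lemma gamma_convolution_pos:
  assumes pos: "0 < \<alpha>p" "0 < lp" "0 < \<alpha>m" "0 < lm" and x: "0 < x"
  shows "(LBINT y. gamma_density \<alpha>p lp (x + y) * gamma_density \<alpha>m lm y) =
    bilateral_gamma_density_pos \<alpha>p lp \<alpha>m lm x"
proof -
  define L where "L = lp + lm"
  have L: "0 < L" using pos by (simp add: L_def)
  define K where "K = lp powr \<alpha>p * lm powr \<alpha>m / (Gamma \<alpha>p * Gamma \<alpha>m) * exp (- lp * x) * L powr (1 - \<alpha>m)"
  have eq: "gamma_density \<alpha>p lp (x + (0 + (1/L) * v)) * gamma_density \<alpha>m lm (0 + (1/L) * v) =
      K * (indicator {0<..} v *\<^sub>R (v powr (\<alpha>m - 1) * (x + v / L) powr (\<alpha>p - 1) * exp (- v)))" for v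
  proof (cases "0 < v")
    case True
    have 1: "(v / L) powr (\<alpha>m - 1) = v powr (\<alpha>m - 1) * L powr (1 - \<alpha>m)"
      using True L by (simp add: powr_divide powr_minus_divide[symmetric] divide_powr_uminus)
    have "- lp * (x + v / L) + - lm * (v / L) = - lp * x - L * (v / L)"
      by (simp add: L_def ring_distribs add_divide_distrib)
    also have "\<dots> = - lp * x + - v" using L by simp
    finally have "exp (- lp * (x + v / L)) * exp (- lm * (v / L)) = exp (- lp * x) * exp (- v)"
      by (simp only: exp_add[symmetric])
    moreover have "0 < v / L" "0 < x + v / L" using True L x by (auto intro: add_pos_pos)
    ultimately show ?thesis
      using True by (simp add: gamma_density_def K_def 1 mult_ac)
  next
    case False
    then have "\<not> 0 < v / L" using L by (simp add: zero_less_divide_iff)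
    with False show ?thesis by (simp add: gamma_density_def)
  qed
  have "(LBINT y. gamma_density \<alpha>p lp (x + y) * gamma_density \<alpha>m lm y) =
     \<bar>1/L\<bar> *\<^sub>R (LBINT v. gamma_density \<alpha>p lp (x + (0 + (1/L) * v)) * gamma_density \<alpha>m lm (0 + (1/L) * v))"
    using L by (intro lborel_integral_real_affine) auto
  also have "\<dots> = (1/L) * (K * (LBINT v:{0<..}. v powr (\<alpha>m - 1) * (x + v / L) powr (\<alpha>p - 1) * exp (- v)))"
    using L unfolding eq set_lebesgue_integral_def by simp
  also have "(1/L) * K = lp powr \<alpha>p * lm powr \<alpha>m / (L powr \<alpha>m * Gamma \<alpha>p * Gamma \<alpha>m) * exp (- lp * x)"
    using L by (simp add: K_def powr_diff)
  then have "(1/L) * (K * I) = lp powr \<alpha>p * lm powr \<alpha>m / (L powr \<alpha>m * Gamma \<alpha>p * Gamma \<alpha>m) * exp (- lp * x) * I" for I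
    by (simp only: mult.assoc[symmetric])
  finally show ?thesis unfolding bilateral_gamma_density_pos_def L_def .
qed

lemma gamma_convolution:
  assumes pos: "0 < \<alpha>p" "0 < lp" "0 < \<alpha>m" "0 < lm" and x: "x \<noteq> 0"
  shows "bilateral_gamma_density \<alpha>p lp \<alpha>m lm x =
    (LBINT y. gamma_density \<alpha>p lp (x + y) * gamma_density \<alpha>m lm y)"
proof (cases "0 < x")
  case True
  then show ?thesis using gamma_convolution_pos[OF pos] by (simp add: bilateral_gamma_density_def)
next
  case False
  have "(LBINT y. gamma_density \<alpha>p lp (x + y) * gamma_density \<alpha>m lm y) =
     \<bar>1\<bar> *\<^sub>R (LBINT y. gamma_density \<alpha>p lp (x + (- x + 1 * y)) * gamma_density \<alpha>m lm (- x + 1 * y))"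
    by (intro lborel_integral_real_affine) auto
  then show ?thesis
    using False x gamma_convolution_pos[OF pos(3,4,1,2), of "- x"]
    by (simp add: bilateral_gamma_density_def mult.commute)
qed

text \<open>The closed formula is a density of the difference of two independent Gamma variables.\<close>

lemma (in prob_space) distributed_bilateral_gamma_density:
  assumes pos: "0 < \<alpha>p" "0 < lp" "0 < \<alpha>m" "0 < lm"
    and indep: "indep_var borel X borel Y"
    and X: "distributed M lborel X (\<lambda>x. ennreal (gamma_density \<alpha>p lp x))"
    and Y: "distributed M lborel Y (\<lambda>x. ennreal (gamma_density \<alpha>m lm x))"
  shows "distributed M lborel (\<lambda>\<omega>. X \<omega> - Y \<omega>) (\<lambda>x. ennreal (bilateral_gamma_density \<alpha>p lp \<alpha>m lm x))"
proof -
  let ?p = "gamma_density \<alpha>p lp" and ?m = "gamma_density \<alpha>m lm"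
  have Y': "distributed M lborel (\<lambda>\<omega>. - Y \<omega>) (\<lambda>x. ennreal (?m (- x)))"
    using distributed_affine[OF Y, of "-1" 0] by (simp add: divide_ennreal_def)
  have indep': "indep_var borel X borel (\<lambda>\<omega>. - Y \<omega>)"
    using indep_var_compose[OF indep, of id borel uminus borel] by (simp add: comp_def)
  define h where "h x = (\<integral>\<^sup>+y. ennreal (?p (x + y) * ?m y) \<partial>lborel)" for x
  have [measurable]: "h \<in> borel_measurable borel" unfolding h_def by measurable
  have "(\<integral>\<^sup>+y. ennreal (?p (x - y)) * ennreal (?m (- y)) \<partial>lborel) = h x" for x
    using nn_integral_real_affine[of "\<lambda>y. ennreal (?p (x - y)) * ennreal (?m (- y))" "-1" 0] pos
    by (simp add: h_def ennreal_mult'[symmetric] gamma_density_nonneg)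
  then have h: "distributed M lborel (\<lambda>\<omega>. X \<omega> - Y \<omega>) h"
    using distributed_convolution[OF indep' X Y'] by simp
  have "(\<integral>\<^sup>+x. h x \<partial>lborel) = 1"
    using distributed_emeasure[OF h, of UNIV] emeasure_space_1 by simp
  then have "AE x in lborel. h x \<noteq> \<infinity>"
    by (intro nn_integral_PInf_AE) auto
  moreover have "AE x in lborel. x \<noteq> (0::real)" by (rule AE_lborel_singleton)
  ultimately have "AE x in lborel. h x = ennreal (bilateral_gamma_density \<alpha>p lp \<alpha>m lm x)"
  proof eventually_elim
    case (elim x)
    have "(LBINT y. ?p (x + y) * ?m y) = enn2real (h x)"
      unfolding h_def using pos by (intro integral_eq_nn_integral) (auto simp: gamma_density_nonneg)
    then show ?case using elim gamma_convolution[OF pos, of x] by (simp add: less_top)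
  qed
  moreover have "(\<lambda>x. ennreal (bilateral_gamma_density \<alpha>p lp \<alpha>m lm x)) \<in> borel_measurable lborel"
  proof -
    have "bilateral_gamma_density \<alpha>p lp \<alpha>m lm =
        (\<lambda>x. if x = 0 then 0 else LBINT y. ?p (x + y) * ?m y)"
      using gamma_convolution[OF pos] by (auto simp: fun_eq_iff) (simp add: bilateral_gamma_density_def)
    then show ?thesis by simp
  qed
  ultimately show ?thesis
    using h by (subst distributed_cong_density[symmetric]) auto
qed

end

theory Submission
  imports Defs "HOL-Real_Asymp.Real_Asymp"
begin

text \<open>
  Let \<open>p, a, m, b\<close> stand for \<open>\<alpha>\<^sup>+, \<lambda>\<^sup>+, \<alpha>\<^sup>-, \<lambda>\<^sup>-\<close>. For \<open>x > 0\<close> write \<open>F\<^sub>p\<^sub>,\<^sub>m\<close> for \<open>a\<^sup>p b\<^sup>m e\<^sup>-\<^sup>a\<^sup>x / (\<Gamma>(p) \<Gamma>(m))\<close> times the integral of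
  \<open>y\<^sup>m\<^sup>-\<^sup>1 (x + y)\<^sup>p\<^sup>-\<^sup>1 e\<^sup>-\<^sup>(\<^sup>a\<^sup>+\<^sup>b\<^sup>)\<^sup>y\<close> over \<open>y > 0\<close>. With \<open>1/\<Gamma>\<close> entire this makes sense for every real \<open>p\<close>,
  and \<open>F\<^sub>p\<^sub>,\<^sub>m' = a (F\<^sub>p\<^sub>-\<^sub>1\<^sub>,\<^sub>m - F\<^sub>p\<^sub>,\<^sub>m)\<close>. So the asymptotics of the \<open>N\<close>-th derivative follow by induction from
  those of \<open>F\<close> itself: each step lowers \<open>p\<close> by one and adds a term of lower order. The base case is a Beta integral
  if \<open>p + m < 1\<close> and a logarithm, found by l'Hopital's rule, if \<open>p + m = 1\<close>. On the negative half line the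
  two parameter pairs are interchanged. Integration by parts gives \<open>F\<^sub>p\<^sub>,\<^sub>m' = b (F\<^sub>p\<^sub>,\<^sub>m - F\<^sub>p\<^sub>,\<^sub>m\<^sub>-\<^sub>1)\<close> for \<open>m > 1\<close>, so
  the jump at \<open>0\<close> satisfies a recursion in both parameters that reduces it to \<open>p + m = 1\<close>. There it is
  the derivative of \<open>1/(\<Gamma>(t) \<Gamma>(1 - t)) = sin (\<pi> t)/\<pi>\<close> at \<open>m\<close>, that is, \<open>cos (\<pi> m)\<close>.
\<close>

section \<open>Gamma and Beta integrals\<close>

text \<open>A limit along \<open>at x within S\<close> can be tested on sequences, which brings in
  the sequential theorem. The domination is only assumed near \<open>x\<close>, so the first
  \<open>N\<close> members of the sequence are dropped.\<close>

lemma integral_dominated_convergence_at: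
  fixes s :: "real \<Rightarrow> 'a \<Rightarrow> real" and f w :: "'a \<Rightarrow> real"
  assumes f: "f \<in> borel_measurable M" and s: "\<And>t. s t \<in> borel_measurable M"
    and w: "integrable M w"
    and lim: "\<And>y. ((\<lambda>t. s t y) \<longlongrightarrow> f y) (at x within S)"
    and bound: "\<forall>\<^sub>F t in at x within S. \<forall>y. \<bar>s t y\<bar> \<le> w y"
  shows "((\<lambda>t. integral\<^sup>L M (s t)) \<longlongrightarrow> integral\<^sup>L M f) (at x within S)"
  unfolding tendsto_at_iff_sequentially comp_def
proof (intro allI impI)
  fix X assume X: "\<forall>i. X i \<in> S - {x}" "X \<longlonglongrightarrow> x"
  then have Xf: "filterlim X (at x within S) sequentially"
    by (auto simp: filterlim_at)
  from filterlim_iff[THEN iffD1, OF Xf, rule_format, OF bound]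
  obtain N where N: "\<And>n. N \<le> n \<Longrightarrow> \<forall>y. \<bar>s (X n) y\<bar> \<le> w y"
    by (auto simp: eventually_sequentially)
  show "(\<lambda>n. integral\<^sup>L M (s (X n))) \<longlonglongrightarrow> integral\<^sup>L M f"
  proof (rule LIMSEQ_offset, rule integral_dominated_convergence)
    show "AE y in M. norm (s (X (n + N)) y) \<le> w y" for n
      using N by auto
    show "AE y in M. (\<lambda>n. s (X (n + N)) y) \<longlonglongrightarrow> f y"
      using LIMSEQ_ignore_initial_segment[OF filterlim_compose[OF lim Xf]] by auto
  qed (use f s w in auto)
qed

lemma Gamma_real_nonzero: "0 < x \<Longrightarrow> Gamma x \<noteq> 0" for x :: real
  by (metis Gamma_real_pos less_irrefl)

text \<open>Substitute \<open>c * y\<close> in Euler's integral. The extended nonnegative form needs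
  no integrability beforehand and can be used inside Tonelli's theorem.\<close>

lemma nn_integral_Gamma:
  fixes m c :: real
  assumes "0 < m" "0 < c"
  shows "(\<integral>\<^sup>+y. ennreal (indicator {0<..} y * (y powr (m - 1) * exp (- (c * y)))) \<partial>lborel)
    = ennreal (Gamma m / c powr m)"
proof -
  have eq: "ennreal (indicator {0..} (0 + c * y) * (0 + c * y) powr (m - 1) / exp (0 + c * y))
     = ennreal (c powr (m - 1)) * ennreal (indicator {0<..} y * (y powr (m - 1) * exp (- (c * y))))" for y
  proof (cases "0 < y")
    case True
    then show ?thesis using assms
      by (simp add: powr_mult exp_minus field_simps flip: ennreal_mult')
  next
    case False
    then show ?thesis using assms
      by (cases "y = 0") (auto simp: indicator_def zero_le_mult_iff)
  qed
  have "ennreal (Gamma m) = \<bar>c\<bar> * (\<integral>\<^sup>+y. ennreal (c powr (m - 1)) *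
      ennreal (indicator {0<..} y * (y powr (m - 1) * exp (- (c * y)))) \<partial>lborel)"
    unfolding Gamma_conv_nn_integral_real[OF assms(1)] eq[symmetric]
    using assms by (intro nn_integral_real_affine) auto
  also have "\<dots> = ennreal (c powr m) *
      (\<integral>\<^sup>+y. ennreal (indicator {0<..} y * (y powr (m - 1) * exp (- (c * y)))) \<partial>lborel)"
    using assms by (subst nn_integral_cmult) (auto simp: powr_mult_base mult.assoc[symmetric] simp flip: ennreal_mult)
  finally have "ennreal (c powr m) *
      (\<integral>\<^sup>+y. ennreal (indicator {0<..} y * (y powr (m - 1) * exp (- (c * y)))) \<partial>lborel)
      = ennreal (c powr m) * ennreal (Gamma m / c powr m)"
    using assms by (simp flip: ennreal_mult')
  then show ?thesis
    using assms by (subst (asm) ennreal_mult_cancel_left) auto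
qed

lemma integrable_Gamma:
  fixes m c :: real
  assumes "0 < m" "0 < c"
  shows "integrable lborel (\<lambda>y. indicator {0<..} y * (y powr (m - 1) * exp (- (c * y))))"
  using assms by (intro integrableI_nn_integral_finite[OF _ _ nn_integral_Gamma[OF assms]]) auto

text \<open>Write \<open>Gamma s / (1 + y) powr s\<close> as a Laplace integral over
  \<open>t\<close> and exchange the integrals. The inner integral over \<open>y\<close> is
  \<open>Gamma m / t powr m\<close>, and what remains is the integral for
  \<open>Gamma (s - m)\<close>.\<close>

lemma has_bochner_integral_beta_prime:
  fixes m s :: real
  assumes "0 < m" "m < s"
  shows "has_bochner_integral lborel (\<lambda>y. indicator {0<..} y * (y powr (m - 1) * (1 + y) powr (- s)))
    (Gamma m * Gamma (s - m) * rGamma s)"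
proof -
  have s: "0 < s" using assms by simp
  have Gs: "Gamma s \<noteq> 0" using Gamma_real_pos[OF s] by linarith
  let ?I = "indicator {0<..} :: real \<Rightarrow> real"
  have "ennreal (Gamma s) * (\<integral>\<^sup>+y. ennreal (?I y * (y powr (m - 1) * (1 + y) powr (- s))) \<partial>lborel)
     = (\<integral>\<^sup>+y. ennreal (?I y * y powr (m - 1)) * ennreal (Gamma s / (1 + y) powr s) \<partial>lborel)"
    using s by (subst nn_integral_cmult[symmetric])
      (auto intro!: nn_integral_cong simp: powr_minus field_simps indicator_def simp flip: ennreal_mult')
  also have "\<dots> = (\<integral>\<^sup>+y. (\<integral>\<^sup>+t. ennreal (?I y * y powr (m - 1)) *
      ennreal (?I t * (t powr (s - 1) * exp (- ((1 + y) * t)))) \<partial>lborel) \<partial>lborel)"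
  proof (intro nn_integral_cong)
    fix y :: real
    show "ennreal (?I y * y powr (m - 1)) * ennreal (Gamma s / (1 + y) powr s) =
      (\<integral>\<^sup>+t. ennreal (?I y * y powr (m - 1)) *
      ennreal (?I t * (t powr (s - 1) * exp (- ((1 + y) * t)))) \<partial>lborel)"
      by (cases "0 < y") (simp_all add: nn_integral_cmult nn_integral_Gamma[OF s])
  qed
  also have "\<dots> = (\<integral>\<^sup>+t. (\<integral>\<^sup>+y. ennreal (?I y * y powr (m - 1)) *
      ennreal (?I t * (t powr (s - 1) * exp (- ((1 + y) * t)))) \<partial>lborel) \<partial>lborel)"
    by (rule lborel_pair.Fubini') simp
  also have "\<dots> = (\<integral>\<^sup>+t. ennreal (Gamma m) * ennreal (?I t * (t powr (s - m - 1) * exp (- (1 * t)))) \<partial>lborel)"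
  proof (intro nn_integral_cong)
    fix t :: real
    show "(\<integral>\<^sup>+y. ennreal (?I y * y powr (m - 1)) *
      ennreal (?I t * (t powr (s - 1) * exp (- ((1 + y) * t)))) \<partial>lborel)
      = ennreal (Gamma m) * ennreal (?I t * (t powr (s - m - 1) * exp (- (1 * t))))"
    proof (cases "0 < t")
      case True
      have "(\<integral>\<^sup>+y. ennreal (?I y * y powr (m - 1)) *
          ennreal (?I t * (t powr (s - 1) * exp (- ((1 + y) * t)))) \<partial>lborel)
        = (\<integral>\<^sup>+y. ennreal (t powr (s - 1) * exp (- t)) *
           ennreal (?I y * (y powr (m - 1) * exp (- (t * y)))) \<partial>lborel)"
        using True by (intro nn_integral_cong) (auto simp: ring_distribs exp_add exp_diff exp_minus field_simps simp flip: ennreal_mult')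
      also have "\<dots> = ennreal (t powr (s - 1) * exp (- t)) * ennreal (Gamma m / t powr m)"
        using True assms by (simp add: nn_integral_cmult nn_integral_Gamma)
      also have "\<dots> = ennreal (Gamma m) * ennreal (?I t * (t powr (s - m - 1) * exp (- (1 * t))))"
        using True assms by (simp add: powr_diff powr_add field_simps flip: ennreal_mult')
      finally show ?thesis .
    qed simp
  qed
  also have "\<dots> = ennreal (Gamma m) * ennreal (Gamma (s - m))"
    using assms nn_integral_Gamma[of "s - m" 1] by (subst nn_integral_cmult) auto
  also have "\<dots> = ennreal (Gamma s) * ennreal (Gamma m * Gamma (s - m) * rGamma s)"
    using assms s Gs by (simp add: rGamma_inverse_Gamma flip: ennreal_mult')
  finally have "(\<integral>\<^sup>+y. ennreal (?I y * (y powr (m - 1) * (1 + y) powr (- s))) \<partial>lborel)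
     = ennreal (Gamma m * Gamma (s - m) * rGamma s)"
    using s Gamma_real_pos[OF s] by (subst (asm) ennreal_mult_cancel_left) auto
  then show ?thesis
    using assms s by (intro has_bochner_integral_nn_integral) (auto simp: rGamma_inverse_Gamma)
qed

lemma rGamma_reflection_real:
  fixes x :: real shows "rGamma x * rGamma (1 - x) = sin (pi * x) / pi"
proof -
  have "complex_of_real (rGamma x * rGamma (1 - x)) = of_real (sin (pi * x) / pi)"
    using rGamma_reflection_complex[of "of_real x"]
    by (simp add: rGamma_complex_of_real[symmetric] sin_of_real[symmetric])
  then show ?thesis by (simp only: of_real_eq_iff)
qed

section \<open>The integral in the density\<close>

text \<open>Up to a constant factor, the substitution y = v/c with c = a + b turns the integrand of
  the density into this kernel. The exponent \<open>q\<close> is left unrestricted because every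
  differentiation in \<open>x\<close> lowers it by one.\<close>

definition bg_kernel :: "real \<Rightarrow> real \<Rightarrow> real \<Rightarrow> real \<Rightarrow> real \<Rightarrow> real" where
  "bg_kernel c m q x y = indicator {0<..} y * (y powr (m - 1) * (x + y) powr (q - 1) * exp (- (c * y)))"

definition bg_integral :: "real \<Rightarrow> real \<Rightarrow> real \<Rightarrow> real \<Rightarrow> real" where
  "bg_integral c m q x = (LBINT y. bg_kernel c m q x y)"

lemma measurable_bg_kernel [measurable]: "bg_kernel c m q x \<in> borel_measurable borel"
  unfolding bg_kernel_def by measurable

lemma bg_kernel_nonneg: "0 \<le> bg_kernel c m q x y"
  by (simp add: bg_kernel_def)

lemma bg_kernel_0: "bg_kernel c m q 0 y = indicator {0<..} y * (y powr (m + q - 1 - 1) * exp (- (c * y)))"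
  by (simp add: bg_kernel_def indicator_def algebra_simps flip: powr_add)

text \<open>A power is monotone in one direction or the other, so an endpoint dominates. Taking the
  sum of both makes one dominating function serve for either sign of the exponent.\<close>

lemma powr_le_sum_endpoints:
  fixes q :: real
  assumes "0 < u" "u \<le> t" "t \<le> v"
  shows "t powr q \<le> u powr q + v powr q"
proof (cases "0 \<le> q")
  case True
  then have "t powr q \<le> v powr q" using assms by (intro powr_mono2) auto
  then show ?thesis by (simp add: add_increasing)
next
  case False
  then have "t powr q \<le> u powr q" using assms by (intro powr_mono2') auto
  then show ?thesis by (simp add: add_increasing2)
qed

text \<open>For \<open>q \<le> 1\<close> the factor in \<open>x + y\<close> is at most
  \<open>x powr (q - 1)\<close>. Otherwise \<open>x + y\<close> is at most twice the larger summand,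
  which leaves two Gamma integrands.\<close>

lemma integrable_bg_kernel:
  assumes "0 < m" "0 < c" "0 < x"
  shows "integrable lborel (bg_kernel c m q x)"
proof (cases "q \<le> 1")
  case True
  have "integrable lborel (\<lambda>y. x powr (q - 1) * (indicator {0<..} y * (y powr (m - 1) * exp (- (c * y)))))"
    using assms by (intro integrable_mult_right integrable_Gamma)
  then show ?thesis
  proof (rule Bochner_Integration.integrable_bound)
    have "bg_kernel c m q x y \<le> x powr (q - 1) * (indicator {0<..} y * (y powr (m - 1) * exp (- (c * y))))" for y
    proof (cases "0 < y")
      case y: True
      have "(x + y) powr (q - 1) \<le> x powr (q - 1)" using True assms y by (intro powr_mono2') auto
      then show ?thesis using y
        by (simp add: bg_kernel_def mult.commute[of "y powr _"] mult.assoc mult_right_mono)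
    qed (simp add: bg_kernel_def)
    then show "AE y in lborel. norm (bg_kernel c m q x y) \<le>
      norm (x powr (q - 1) * (indicator {0<..} y * (y powr (m - 1) * exp (- (c * y)))))"
      by (simp add: bg_kernel_nonneg)
  qed simp
next
  case False
  let ?w = "\<lambda>y::real. (2 * x) powr (q - 1) * (indicator {0<..} y * (y powr (m - 1) * exp (- (c * y))))
     + 2 powr (q - 1) * (indicator {0<..} y * (y powr (m + q - 1 - 1) * exp (- (c * y))))"
  have "integrable lborel ?w"
    using assms False by (intro Bochner_Integration.integrable_add integrable_mult_right integrable_Gamma) auto
  then show ?thesis
  proof (rule Bochner_Integration.integrable_bound)
    have "bg_kernel c m q x y \<le> ?w y" for y
    proof (cases "0 < y")
      case y: True
      have "(x + y) powr (q - 1) \<le> (2 * x) powr (q - 1) + (2 * y) powr (q - 1)"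
      proof (cases "x \<le> y")
        case True
        then have "(x + y) powr (q - 1) \<le> (2 * y) powr (q - 1)" using False assms y by (intro powr_mono2) auto
        then show ?thesis by (simp add: add_increasing)
      next
        case c: False
        then have "(x + y) powr (q - 1) \<le> (2 * x) powr (q - 1)" using False assms y by (intro powr_mono2) auto
        then show ?thesis by (simp add: add_increasing2)
      qed
      then have "(x + y) powr (q - 1) * (y powr (m - 1) * exp (- (c * y)))
         \<le> ((2 * x) powr (q - 1) + (2 * y) powr (q - 1)) * (y powr (m - 1) * exp (- (c * y)))"
        by (intro mult_right_mono) auto
      moreover have "y powr (m + q - 1 - 1) = y powr (m - 1) * y powr (q - 1)"
        by (simp add: algebra_simps flip: powr_add)
      ultimately show ?thesis using y
        by (simp add: bg_kernel_def powr_mult algebra_simps)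
    qed (simp add: bg_kernel_def)
    then have "norm (bg_kernel c m q x y) \<le> norm (?w y)" for y
      unfolding real_norm_def abs_of_nonneg[OF bg_kernel_nonneg] by (rule order_trans) (rule abs_ge_self)
    then show "AE y in lborel. norm (bg_kernel c m q x y) \<le> norm (?w y)"
      by (rule AE_I2)
  qed simp
qed

lemma DERIV_bg_kernel:
  assumes "0 < x"
  shows "((\<lambda>t. bg_kernel c m q t y) has_real_derivative (q - 1) * bg_kernel c m (q - 1) x y) (at x)"
proof (cases "0 < y")
  case True
  have "((\<lambda>t. (t + y) powr (q - 1)) has_real_derivative (q - 1) * (x + y) powr (q - 1 - 1) * 1) (at x)"
    using True assms by (intro DERIV_chain2[OF has_real_derivative_powr]) (auto intro!: derivative_eq_intros)
  from DERIV_cmult[OF this, of "y powr (m - 1) * exp (- (c * y))"] True show ?thesis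
    by (simp add: bg_kernel_def mult_ac)
qed (simp add: bg_kernel_def)

text \<open>Differentiation under the integral sign. By the mean value theorem a difference quotient
  is the derivative at some point of (x/2, 2x), and the values at the two ends of this interval
  dominate it uniformly.\<close>

lemma DERIV_bg_integral:
  assumes m: "0 < m" "0 < c" and x: "0 < x"
  shows "(bg_integral c m q has_real_derivative (q - 1) * bg_integral c m (q - 1) x) (at x)"
proof -
  let ?w = "\<lambda>y. \<bar>q - 1\<bar> * (bg_kernel c m (q - 1) (x / 2) y + bg_kernel c m (q - 1) (2 * x) y)"
  have "((\<lambda>t. LBINT y. (bg_kernel c m q t y - bg_kernel c m q x y) / (t - x))
      \<longlongrightarrow> (LBINT y. (q - 1) * bg_kernel c m (q - 1) x y)) (at x)"
  proof (rule integral_dominated_convergence_at)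
    show "integrable lborel ?w"
      using m x by (intro integrable_mult_right Bochner_Integration.integrable_add integrable_bg_kernel) auto
  next
    fix y
    show "((\<lambda>t. (bg_kernel c m q t y - bg_kernel c m q x y) / (t - x))
      \<longlongrightarrow> (q - 1) * bg_kernel c m (q - 1) x y) (at x)"
      using DERIV_bg_kernel[OF x] by (simp add: has_field_derivative_iff)
  next
    have "\<bar>(bg_kernel c m q t y - bg_kernel c m q x y) / (t - x)\<bar> \<le> ?w y"
      if t: "t \<noteq> x" "x / 2 < t" "t < 2 * x" for t y
    proof (cases "0 < y")
      case True
      have "\<exists>\<xi>\<in>{x/2<..<2*x}. bg_kernel c m q t y - bg_kernel c m q x y = (t - x) * ((q - 1) * bg_kernel c m (q - 1) \<xi> y)"
      proof -
        have D: "((\<lambda>t. bg_kernel c m q t y) has_real_derivative (q - 1) * bg_kernel c m (q - 1) s y) (at s)"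
          if "x / 2 < s" for s
          using that x by (intro DERIV_bg_kernel) auto
        show ?thesis
        proof (cases "t < x")
          case True
          with t D obtain z where "t < z" "z < x"
            "bg_kernel c m q x y - bg_kernel c m q t y = (x - t) * ((q - 1) * bg_kernel c m (q - 1) z y)"
            using MVT2[of t x "\<lambda>t. bg_kernel c m q t y" "\<lambda>z. (q - 1) * bg_kernel c m (q - 1) z y"] by force
          with t x show ?thesis by (intro bexI[of _ z]) (auto simp: algebra_simps)
        next
          case False
          with t D x obtain z where "x < z" "z < t"
            "bg_kernel c m q t y - bg_kernel c m q x y = (t - x) * ((q - 1) * bg_kernel c m (q - 1) z y)"
            using MVT2[of x t "\<lambda>t. bg_kernel c m q t y" "\<lambda>z. (q - 1) * bg_kernel c m (q - 1) z y"] by force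
          with t x show ?thesis by (intro bexI[of _ z]) auto
        qed
      qed
      then obtain \<xi> where xi: "x / 2 < \<xi>" "\<xi> < 2 * x"
        "bg_kernel c m q t y - bg_kernel c m q x y = (t - x) * ((q - 1) * bg_kernel c m (q - 1) \<xi> y)"
        by auto
      have "(\<xi> + y) powr (q - 1 - 1) \<le> (x / 2 + y) powr (q - 1 - 1) + (2 * x + y) powr (q - 1 - 1)"
        using xi x True by (intro powr_le_sum_endpoints) auto
      then have "(\<xi> + y) powr (q - 1 - 1) * (y powr (m - 1) * exp (- (c * y))) \<le>
         ((x / 2 + y) powr (q - 1 - 1) + (2 * x + y) powr (q - 1 - 1)) * (y powr (m - 1) * exp (- (c * y)))"
        by (intro mult_right_mono) auto
      then have "bg_kernel c m (q - 1) \<xi> y \<le> bg_kernel c m (q - 1) (x / 2) y + bg_kernel c m (q - 1) (2 * x) y"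
        using True by (simp add: bg_kernel_def algebra_simps)
      then show ?thesis using xi(3) t
        by (simp add: abs_mult bg_kernel_nonneg mult_left_mono)
    qed (simp add: bg_kernel_def)
    moreover have "\<forall>\<^sub>F t in at x. t \<noteq> x \<and> x / 2 < t \<and> t < 2 * x"
      using x by (intro eventually_conj eventually_neq_at_within order_tendstoD[OF tendsto_ident_at]) auto
    ultimately show "\<forall>\<^sub>F t in at x. \<forall>y. \<bar>(bg_kernel c m q t y - bg_kernel c m q x y) / (t - x)\<bar> \<le> ?w y"
      by (auto elim!: eventually_mono)
  qed auto
  moreover have "\<forall>\<^sub>F t in at x. (LBINT y. (bg_kernel c m q t y - bg_kernel c m q x y) / (t - x))
     = (bg_integral c m q t - bg_integral c m q x) / (t - x)"
    using order_tendstoD(1)[OF tendsto_ident_at x, of UNIV]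
  proof eventually_elim
    case (elim t)
    then show ?case using m x
      by (simp add: bg_integral_def Bochner_Integration.integral_diff integrable_bg_kernel)
  qed
  ultimately have "((\<lambda>t. (bg_integral c m q t - bg_integral c m q x) / (t - x))
      \<longlongrightarrow> (LBINT y. (q - 1) * bg_kernel c m (q - 1) x y)) (at x)"
    by (rule Lim_transform_eventually)
  then show ?thesis
    by (simp add: has_field_derivative_iff bg_integral_def)
qed

text \<open>At \<open>x = 0\<close> the kernel behaves like y to the power m + q - 2 near the
  origin, which is integrable exactly when m + q > 1. The kernels at 0 and 1 together dominate those
  in between.\<close>

lemma bg_integral_tendsto_0:
  assumes "0 < m" "0 < c" "1 < m + q"
  shows "(bg_integral c m q \<longlongrightarrow> (LBINT y. bg_kernel c m q 0 y)) (at_right 0)"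
  unfolding bg_integral_def
proof (rule integral_dominated_convergence_at)
  let ?w = "\<lambda>y. bg_kernel c m q 0 y + bg_kernel c m q 1 y"
  show "integrable lborel ?w"
    using assms unfolding bg_kernel_0
    by (intro Bochner_Integration.integrable_add integrable_bg_kernel integrable_Gamma) auto
  have "\<bar>bg_kernel c m q t y\<bar> \<le> ?w y" if t: "0 < t" "t < 1" for t y
  proof (cases "0 < y")
    case True
    have "(t + y) powr (q - 1) \<le> (0 + y) powr (q - 1) + (1 + y) powr (q - 1)"
      using t True by (intro powr_le_sum_endpoints) auto
    then have "(t + y) powr (q - 1) * (y powr (m - 1) * exp (- (c * y))) \<le>
       ((0 + y) powr (q - 1) + (1 + y) powr (q - 1)) * (y powr (m - 1) * exp (- (c * y)))"
      by (intro mult_right_mono) auto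
    then show ?thesis
      using True by (simp add: bg_kernel_def algebra_simps)
  qed (simp add: bg_kernel_def)
  then show "\<forall>\<^sub>F t in at_right 0. \<forall>y. \<bar>bg_kernel c m q t y\<bar> \<le> ?w y"
    by (auto intro!: eventually_mono[OF eventually_at_right_real[of 0 1]])
  fix y
  show "((\<lambda>t. bg_kernel c m q t y) \<longlongrightarrow> bg_kernel c m q 0 y) (at_right 0)"
  proof (cases "0 < y")
    case True
    then show ?thesis unfolding bg_kernel_def by (auto intro!: tendsto_eq_intros)
  qed (simp add: bg_kernel_def)
qed auto

text \<open>Substituting \<open>x * y\<close> for \<open>y\<close> moves the small parameter into
  the exponential rate: only \<open>c * x\<close> still depends on it, apart from an explicit
  power.\<close>

lemma bg_integral_scale:
  assumes "0 < x"
  shows "bg_integral c m q x = x powr (m + q - 1) * bg_integral (c * x) m q 1"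
proof -
  have "bg_kernel c m q x (0 + x * y) = x powr (m + q - 2) * bg_kernel (c * x) m q 1 y" for y
  proof (cases "0 < y")
    case True
    have "x + x * y = x * (1 + y)" by (simp add: algebra_simps)
    moreover have "x powr (m + q - 2) = x powr (m - 1) * x powr (q - 1)"
      by (simp flip: powr_add add: algebra_simps)
    ultimately show ?thesis using True assms
      by (simp add: bg_kernel_def powr_mult mult_ac)
  next
    case False
    then have "\<not> 0 < x * y" using assms by (simp add: zero_less_mult_iff)
    with False show ?thesis by (simp add: bg_kernel_def)
  qed
  then have "bg_integral c m q x = x * (x powr (m + q - 2) * bg_integral (c * x) m q 1)"
    using assms lborel_integral_real_affine[of x "bg_kernel c m q x" 0] by (simp add: bg_integral_def)
  moreover have "x * x powr (m + q - 2) = x powr (1 + (m + q - 2))"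
    using assms by (intro powr_mult_base) auto
  moreover have "1 + (m + q - 2) = m + q - 1" by simp
  ultimately show ?thesis by (simp only: mult.assoc[symmetric])
qed

text \<open>After scaling, the exponential tends to 1 from below, and the Beta prime integral with s
  = 1 - q remains. Its convergence condition m < s is m + q < 1.\<close>

lemma bg_integral_singular:
  assumes "0 < m" "0 < c" "m + q < 1"
  shows "((\<lambda>x. x powr (1 - m - q) * bg_integral c m q x) \<longlongrightarrow> Gamma m * Gamma (1 - m - q) * rGamma (1 - q))
    (at_right 0)"
proof -
  let ?h = "\<lambda>y::real. indicator {0<..} y * (y powr (m - 1) * (1 + y) powr (- (1 - q)))"
  have h: "has_bochner_integral lborel ?h (Gamma m * Gamma (1 - m - q) * rGamma (1 - q))"
    using has_bochner_integral_beta_prime[of m "1 - q"] assms by (simp add: algebra_simps)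
  have "((\<lambda>x. LBINT y. bg_kernel (c * x) m q 1 y) \<longlongrightarrow> (LBINT y. ?h y)) (at_right 0)"
  proof (rule integral_dominated_convergence_at)
    show "integrable lborel ?h" using h by (simp add: has_bochner_integral_iff)
    have "\<bar>bg_kernel (c * t) m q 1 y\<bar> \<le> ?h y" if t: "0 < t" for t y
      using t assms by (cases "0 < y") (auto simp: bg_kernel_def abs_mult intro!: mult_left_le)
    then show "\<forall>\<^sub>F t in at_right 0. \<forall>y. \<bar>bg_kernel (c * t) m q 1 y\<bar> \<le> ?h y"
      by (auto intro!: eventually_mono[OF eventually_at_right_real[of 0 1]])
    fix y
    show "((\<lambda>t. bg_kernel (c * t) m q 1 y) \<longlongrightarrow> ?h y) (at_right 0)"
      unfolding bg_kernel_def by (auto intro!: tendsto_eq_intros)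
  qed auto
  then have "((\<lambda>x. bg_integral (c * x) m q 1) \<longlongrightarrow> Gamma m * Gamma (1 - m - q) * rGamma (1 - q)) (at_right 0)"
    using h by (simp add: bg_integral_def has_bochner_integral_iff)
  moreover have "\<forall>\<^sub>F x in at_right 0. bg_integral (c * x) m q 1 = x powr (1 - m - q) * bg_integral c m q x"
    by (auto intro!: eventually_mono[OF eventually_at_right_real[of 0 1]]
      simp: bg_integral_scale[of _ c] mult.assoc[symmetric] simp flip: powr_add)
  ultimately show ?thesis by (rule Lim_transform_eventually)
qed

text \<open>The derivative is -m times the integral with exponent parameter -m, which is asymptotic
  to 1/(m x) by the singular case. This form of l'Hopital's rule only asks the denominator to
  diverge.\<close>

lemma bg_integral_log:
  assumes "0 < m" "0 < c"
  shows "((\<lambda>x. bg_integral c m (1 - m) x / ln (1 / x)) \<longlongrightarrow> 1) (at_right 0)"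
proof (rule lhopital_right_0_at_top)
  show "filterlim (\<lambda>x. ln (1 / x)) at_top (at_right (0::real))" by real_asymp
  have ev: "\<forall>\<^sub>F x in at_right (0::real). 0 < x" by (rule eventually_at_right_less)
  show "\<forall>\<^sub>F x in at_right 0. (bg_integral c m (1 - m) has_real_derivative - m * bg_integral c m (- m) x) (at x)"
    using ev by eventually_elim (use DERIV_bg_integral[of m c _ "1 - m"] assms in auto)
  show "\<forall>\<^sub>F x in at_right 0. ((\<lambda>x. ln (1 / x)) has_real_derivative - 1 / x) (at x)"
    using ev by eventually_elim (auto intro!: derivative_eq_intros simp: field_simps power2_eq_square)
  show "\<forall>\<^sub>F x in at_right (0::real). - 1 / x \<noteq> 0"
    using ev by eventually_elim auto
  have "m * (Gamma m * rGamma (1 + m)) = Gamma m * rGamma m"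
    using rGamma_plus1[of m] by (simp add: add.commute mult.left_commute)
  also have "\<dots> = 1"
    using Gamma_real_pos[OF assms(1)] by (simp add: rGamma_inverse_Gamma)
  finally have "Gamma m * rGamma (1 + m) = inverse m"
    using assms by (simp add: field_simps)
  then have "((\<lambda>x. m * (x powr 1 * bg_integral c m (- m) x)) \<longlongrightarrow> 1) (at_right 0)"
    using tendsto_mult_left[OF bg_integral_singular[of m c "- m"], of m] assms by simp
  moreover have "\<forall>\<^sub>F x in at_right 0. m * (x powr 1 * bg_integral c m (- m) x) = - m * bg_integral c m (- m) x / (- 1 / x)"
    using ev by eventually_elim (auto simp: field_simps)
  ultimately show "((\<lambda>x. - m * bg_integral c m (- m) x / (- 1 / x)) \<longlongrightarrow> 1) (at_right 0)"
    by (rule Lim_transform_eventually)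
qed

section \<open>The critical case \<open>p + m = 1\<close>\<close>

text \<open>The numerator vanishes at \<epsilon> = 0, and its derivative there equals that of
  \<open>rGamma t * rGamma (1 - t)\<close> at \<open>t = m\<close>. By reflection this product is
  sin (pi t)/pi, so the derivatives of \<open>rGamma\<close> never have to be evaluated.\<close>

lemma rGamma_difference_quotient:
  fixes m :: real
  assumes "0 < m" "m < 1"
  shows "((\<lambda>\<epsilon>. (rGamma (1 - m) * rGamma (m + \<epsilon>) - rGamma m * rGamma (1 - m + \<epsilon>)) / \<epsilon>)
    \<longlongrightarrow> cos (pi * m)) (at_right 0)"
proof -
  have [simp]: "m \<notin> \<int>\<^sub>\<le>\<^sub>0" "1 - m \<notin> \<int>\<^sub>\<le>\<^sub>0"
    using assms by (auto dest: nonpos_Ints_nonpos)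
  obtain d e where d: "(rGamma has_real_derivative d) (at m)" and e: "(rGamma has_real_derivative e) (at (1 - m))"
    using has_field_derivative_rGamma_no_nonpos_int[of m] has_field_derivative_rGamma_no_nonpos_int[of "1 - m"]
    by auto
  have "((\<lambda>t. rGamma (1 - t)) has_real_derivative e * (0 - 1)) (at m)"
    by (rule DERIV_chain2[where f = rGamma and g = "\<lambda>t. 1 - t"]) (use e in \<open>auto intro!: derivative_eq_intros\<close>)
  from DERIV_mult[OF d this]
  have "((\<lambda>t. rGamma t * rGamma (1 - t)) has_real_derivative (d * rGamma (1 - m) - e * rGamma m)) (at m)"
    by (simp add: algebra_simps)
  moreover have "((\<lambda>t. rGamma t * rGamma (1 - t)) has_real_derivative cos (pi * m)) (at m)"
    unfolding rGamma_reflection_real by (auto intro!: derivative_eq_intros)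
  ultimately have de: "d * rGamma (1 - m) - e * rGamma m = cos (pi * m)"
    by (rule DERIV_unique)
  have "((\<lambda>\<epsilon>. rGamma (1 - m) * rGamma (m + \<epsilon>) - rGamma m * rGamma (1 - m + \<epsilon>)) has_real_derivative cos (pi * m)) (at 0)"
  proof -
    have "((\<lambda>\<epsilon>. rGamma (m + \<epsilon>)) has_real_derivative d * (0 + 1)) (at 0)"
      by (rule DERIV_chain2[where f = rGamma and g = "\<lambda>t. m + t"]) (use d in \<open>auto intro!: derivative_eq_intros\<close>)
    moreover have "((\<lambda>\<epsilon>. rGamma (1 - m + \<epsilon>)) has_real_derivative e * (0 + 1)) (at 0)"
      by (rule DERIV_chain2[where f = rGamma and g = "\<lambda>t. 1 - m + t"]) (use e in \<open>auto intro!: derivative_eq_intros\<close>)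
    ultimately show ?thesis
      unfolding de[symmetric] using DERIV_diff[OF DERIV_cmult DERIV_cmult] by (fastforce simp: mult.commute)
  qed
  then have "((\<lambda>\<epsilon>. (rGamma (1 - m) * rGamma (m + \<epsilon>) - rGamma m * rGamma (1 - m + \<epsilon>)) / \<epsilon>)
    \<longlongrightarrow> cos (pi * m)) (at 0)"
    by (simp add: has_field_derivative_iff mult.commute)
  then show ?thesis by (rule tendsto_mono[rotated]) (simp add: at_le)
qed

text \<open>The difference of the kernels with parameters (m, 1 - m) and (1 - m, m), taken at
  \<open>x = 1\<close> with exponential rate 0. At infinity the leading terms 1/y cancel.\<close>

definition beta_prime_gap :: "real \<Rightarrow> real \<Rightarrow> real" where
  "beta_prime_gap m y = indicator {0<..} y * (y powr (m - 1) * (1 + y) powr (- m) - y powr (- m) * (1 + y) powr (m - 1))"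

text \<open>With u = y/(1 + y) < 1, the condition m \<le> 1/2 says m - 1 \<le> -m, so u to the power
  -m is at most u to the power m - 1. Dividing by 1 + y gives the two terms of the gap.\<close>

lemma beta_prime_gap_nonneg:
  assumes "0 < m" "m \<le> 1 / 2"
  shows "0 \<le> beta_prime_gap m y"
proof (cases "0 < y")
  case True
  have "(y / (1 + y)) powr (- m) \<le> (y / (1 + y)) powr (m - 1)"
    using True assms by (intro powr_mono') auto
  then have "y powr (- m) * (1 + y) powr m \<le> y powr (m - 1) * (1 + y) powr (1 - m)"
    using True by (simp add: powr_divide divide_powr_uminus)
  then have "y powr (- m) * (1 + y) powr m * (1 + y) powr (-1) \<le> y powr (m - 1) * (1 + y) powr (1 - m) * (1 + y) powr (-1)"
    by (rule mult_right_mono) (rule powr_ge_zero)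
  moreover have "(1 + y) powr m * (1 + y) powr (-1) = (1 + y) powr (m - 1)"
    "(1 + y) powr (1 - m) * (1 + y) powr (-1) = (1 + y) powr (- m)"
    by (simp_all only: powr_add[symmetric]) simp_all
  ultimately have "y powr (- m) * (1 + y) powr (m - 1) \<le> y powr (m - 1) * (1 + y) powr (- m)"
    by (simp only: mult.assoc)
  then show ?thesis
    using True by (simp add: beta_prime_gap_def)
qed (simp add: beta_prime_gap_def)

text \<open>The difference of the two Beta prime integrands is integrable although neither of them is. As it has
  constant sign, inserting \<open>(1 + y)\<^sup>-\<^sup>\<epsilon>\<close> and letting \<open>\<epsilon> \<down> 0\<close> yields integrability and the value together.\<close>

lemma has_bochner_integral_beta_prime_gap_aux:
  assumes m: "0 < m" "m \<le> 1 / 2"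
  shows "has_bochner_integral lborel (beta_prime_gap m) (Gamma m * Gamma (1 - m) * cos (pi * m))"
proof -
  define e where "e n = 1 / real (Suc n)" for n
  define f where "f n y = beta_prime_gap m y * (1 + y) powr (- e n)" for n y
  define I where "I \<epsilon> = Gamma m * Gamma \<epsilon> * rGamma (m + \<epsilon>) - Gamma (1 - m) * Gamma \<epsilon> * rGamma (1 - m + \<epsilon>)" for \<epsilon>
  have e: "0 < e n" "e (Suc n) \<le> e n" for n by (simp_all add: e_def frac_le)
  have nz: "Gamma m \<noteq> 0" "Gamma (1 - m) \<noteq> 0"
    using m by (auto simp: Gamma_eq_zero_iff dest: nonpos_Ints_nonpos)
  have f: "has_bochner_integral lborel (f n) (I (e n))" for n
  proof -
    have "has_bochner_integral lborel
       (\<lambda>y. indicator {0<..} y * (y powr (m - 1) * (1 + y) powr (- (m + e n))) -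
            indicator {0<..} y * (y powr (1 - m - 1) * (1 + y) powr (- (1 - m + e n))))
       (Gamma m * Gamma (m + e n - m) * rGamma (m + e n) - Gamma (1 - m) * Gamma (1 - m + e n - (1 - m)) * rGamma (1 - m + e n))"
      using m e(1)[of n] by (intro has_bochner_integral_diff has_bochner_integral_beta_prime) auto
    also have "(\<lambda>y. indicator {0<..} y * (y powr (m - 1) * (1 + y) powr (- (m + e n))) -
            indicator {0<..} y * (y powr (1 - m - 1) * (1 + y) powr (- (1 - m + e n)))) = f n"
      by (auto simp: fun_eq_iff f_def beta_prime_gap_def left_diff_distrib right_diff_distrib mult.assoc simp flip: powr_add)
    finally show ?thesis by (simp add: I_def)
  qed
  have lim: "(\<lambda>n. integral\<^sup>L lborel (f n)) \<longlonglongrightarrow> Gamma m * Gamma (1 - m) * cos (pi * m)"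
  proof -
    \<comment> \<open>Both integrals in \<open>I \<epsilon>\<close> carry the factor
      \<open>Gamma \<epsilon>\<close>. Writing it as
      \<open>Gamma (\<epsilon> + 1) / \<epsilon>\<close> turns the pole into the denominator of the
      difference quotient above.\<close>
    have "((\<lambda>\<epsilon>. Gamma (\<epsilon> + 1) * (Gamma m * Gamma (1 - m) *
       ((rGamma (1 - m) * rGamma (m + \<epsilon>) - rGamma m * rGamma (1 - m + \<epsilon>)) / \<epsilon>)))
      \<longlongrightarrow> Gamma (0 + 1) * (Gamma m * Gamma (1 - m) * cos (pi * m))) (at_right 0)"
      using m by (intro tendsto_intros rGamma_difference_quotient) auto
    moreover have "\<forall>\<^sub>F \<epsilon> in at_right 0. Gamma (\<epsilon> + 1) * (Gamma m * Gamma (1 - m) *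
       ((rGamma (1 - m) * rGamma (m + \<epsilon>) - rGamma m * rGamma (1 - m + \<epsilon>)) / \<epsilon>)) = I \<epsilon>"
      using eventually_at_right_less[of "0::real"]
    proof eventually_elim
      case (elim \<epsilon>)
      then have "Gamma (\<epsilon> + 1) = \<epsilon> * Gamma \<epsilon>" by (intro Gamma_plus1) (auto dest: nonpos_Ints_nonpos)
      with elim nz show ?case by (simp add: I_def rGamma_inverse_Gamma[of m] rGamma_inverse_Gamma[of "1 - m"] field_simps)
    qed
    ultimately have "(I \<longlongrightarrow> Gamma m * Gamma (1 - m) * cos (pi * m)) (at_right 0)"
      by (simp add: Lim_transform_eventually)
    moreover have "filterlim e (at_right 0) sequentially"
      unfolding e_def by real_asymp
    ultimately have "(\<lambda>n. I (e n)) \<longlonglongrightarrow> Gamma m * Gamma (1 - m) * cos (pi * m)"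
      by (rule filterlim_compose)
    then show ?thesis using f by (simp add: has_bochner_integral_iff)
  qed
  have mono: "mono (\<lambda>n. f n y)" for y
  proof (rule incseq_SucI)
    fix n
    show "f n y \<le> f (Suc n) y"
    proof (cases "0 < y")
      case True
      have "(1 + y) powr (- e n) \<le> (1 + y) powr (- e (Suc n))"
        using True e by (intro powr_mono) auto
      then show ?thesis unfolding f_def using beta_prime_gap_nonneg[OF m] by (intro mult_left_mono)
    qed (simp add: f_def beta_prime_gap_def)
  qed
  have pointwise: "(\<lambda>n. f n y) \<longlonglongrightarrow> beta_prime_gap m y" for y
  proof (cases "0 < y")
    case True
    have "(\<lambda>n. (1 + y) powr (- e n)) \<longlonglongrightarrow> 1"
      using True unfolding e_def by real_asymp
    from tendsto_mult_left[OF this, of "beta_prime_gap m y"] show ?thesis by (simp add: f_def)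
  qed (simp add: f_def beta_prime_gap_def)
  have nn: "0 \<le> f n y" for n y
    using beta_prime_gap_nonneg[OF m] by (simp add: f_def)
  have meas: "beta_prime_gap m \<in> borel_measurable lborel"
    unfolding beta_prime_gap_def by measurable
  show ?thesis
    using integral_monotone_convergence_nonneg[of lborel f "beta_prime_gap m", OF _ _ _ _ lim meas] f mono nn pointwise
    by (auto simp: has_bochner_integral_iff)
qed

text \<open>Replacing m by 1 - m changes the sign of the gap and of cos (pi m) alike, which carries
  the result over to m > 1/2.\<close>

lemma has_bochner_integral_beta_prime_gap:
  assumes m: "0 < m" "m < 1"
  shows "has_bochner_integral lborel (beta_prime_gap m) (Gamma m * Gamma (1 - m) * cos (pi * m))"
proof (cases "m \<le> 1 / 2")
  case False
  then have "has_bochner_integral lborel (\<lambda>y. - beta_prime_gap (1 - m) y)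
     (- (Gamma (1 - m) * Gamma (1 - (1 - m)) * cos (pi * (1 - m))))"
    using m by (intro has_bochner_integral_minus has_bochner_integral_beta_prime_gap_aux) auto
  moreover have "(\<lambda>y. - beta_prime_gap (1 - m) y) = beta_prime_gap m"
    by (auto simp: beta_prime_gap_def fun_eq_iff algebra_simps)
  moreover have "cos (pi * (1 - m)) = - cos (pi * m)"
    by (simp add: right_diff_distrib cos_diff)
  ultimately show ?thesis by (simp add: mult_ac)
qed (use has_bochner_integral_beta_prime_gap_aux m in simp)

text \<open>For exponents with sum 1 the power in the scaling rule is 1. The difference is thus the
  integral of the gap against exp (-c x y), dominated by the absolute value of the gap.\<close>

lemma bg_integral_gap:
  assumes "0 < m" "m < 1" "0 < c"
  shows "((\<lambda>x. bg_integral c m (1 - m) x - bg_integral c (1 - m) m x)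
    \<longlongrightarrow> Gamma m * Gamma (1 - m) * cos (pi * m)) (at_right 0)"
proof -
  note h = has_bochner_integral_beta_prime_gap[OF assms(1,2)]
  have meas: "beta_prime_gap m \<in> borel_measurable lborel"
    unfolding beta_prime_gap_def by measurable
  have "((\<lambda>x. LBINT y. beta_prime_gap m y * exp (- (c * x * y)) * indicator {0<..} y) \<longlongrightarrow> (LBINT y. beta_prime_gap m y)) (at_right 0)"
  proof (rule integral_dominated_convergence_at)
    show "integrable lborel (\<lambda>y. \<bar>beta_prime_gap m y\<bar>)"
      using h by (simp add: has_bochner_integral_iff)
    have "\<bar>beta_prime_gap m y * exp (- (c * t * y)) * indicator {0<..} y\<bar> \<le> \<bar>beta_prime_gap m y\<bar>" if t: "0 < t" for t y
      using t assms by (cases "0 < y") (auto simp: abs_mult intro!: mult_left_le)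
    then show "\<forall>\<^sub>F t in at_right 0. \<forall>y. \<bar>beta_prime_gap m y * exp (- (c * t * y)) * indicator {0<..} y\<bar> \<le> \<bar>beta_prime_gap m y\<bar>"
      by (auto intro!: eventually_mono[OF eventually_at_right_real[of 0 1]])
    fix y :: real
    show "((\<lambda>t. beta_prime_gap m y * exp (- (c * t * y)) * indicator {0<..} y) \<longlongrightarrow> beta_prime_gap m y) (at_right 0)"
      by (cases "0 < y") (auto intro!: tendsto_eq_intros simp: beta_prime_gap_def)
  qed (use meas in auto)
  moreover have "\<forall>\<^sub>F x in at_right 0. (LBINT y. beta_prime_gap m y * exp (- (c * x * y)) * indicator {0<..} y)
      = bg_integral c m (1 - m) x - bg_integral c (1 - m) m x"
    using eventually_at_right_less[of "0::real"]
  proof eventually_elim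
    case (elim x)
    have "bg_integral c m (1 - m) x - bg_integral c (1 - m) m x =
      bg_integral (c * x) m (1 - m) 1 - bg_integral (c * x) (1 - m) m 1"
      using elim by (simp add: bg_integral_scale[of x c])
    also have "\<dots> = (LBINT y. bg_kernel (c * x) m (1 - m) 1 y - bg_kernel (c * x) (1 - m) m 1 y)"
      unfolding bg_integral_def using assms elim
      by (intro Bochner_Integration.integral_diff[symmetric] integrable_bg_kernel) auto
    also have "\<dots> = (LBINT y. beta_prime_gap m y * exp (- (c * x * y)) * indicator {0<..} y)"
      by (intro Bochner_Integration.integral_cong)
        (auto simp: bg_kernel_def beta_prime_gap_def indicator_def algebra_simps)
    finally show ?case ..
  qed
  ultimately have "((\<lambda>x. bg_integral c m (1 - m) x - bg_integral c (1 - m) m x)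
      \<longlongrightarrow> (LBINT y. beta_prime_gap m y)) (at_right 0)"
    by (rule Lim_transform_eventually)
  then show ?thesis
    using h by (simp add: has_bochner_integral_iff)
qed

section \<open>Derivatives of the density\<close>

text \<open>The three terms are those of the derivative in y of y^(m-1) (x + y)^(q-1) exp (-c y).
  Its limit at 0 vanishes because m > 1, its limit at infinity because of the exponential.\<close>

lemma bg_integral_parts:
  assumes "1 < m" "0 < c" "0 < x"
  shows "(m - 1) * bg_integral c (m - 1) q x + (q - 1) * bg_integral c m (q - 1) x = c * bg_integral c m q x"
proof -
  let ?F = "\<lambda>y. y powr (m - 1) * (x + y) powr (q - 1) * exp (- (c * y))"
  let ?f = "\<lambda>y. (m - 1) * bg_kernel c (m - 1) q x y + (q - 1) * bg_kernel c m (q - 1) x y - c * bg_kernel c m q x y"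
  have int: "integrable lborel (bg_kernel c (m - 1) q x)" "integrable lborel (bg_kernel c m (q - 1) x)"
     "integrable lborel (bg_kernel c m q x)"
    using assms by (auto intro!: integrable_bg_kernel)
  have D: "(?F has_real_derivative ?f y) (at y)" if y: "0 < y" for y
  proof -
    have 1: "((\<lambda>y. y powr (m - 1)) has_real_derivative (m - 1) * y powr (m - 1 - 1)) (at y)"
      using y by (intro has_real_derivative_powr)
    have 2: "((\<lambda>y. (x + y) powr (q - 1)) has_real_derivative (q - 1) * (x + y) powr (q - 1 - 1) * 1) (at y)"
      using y assms by (intro DERIV_chain2[OF has_real_derivative_powr]) (auto intro!: derivative_eq_intros)
    have 3: "((\<lambda>y. exp (- (c * y))) has_real_derivative - c * exp (- (c * y))) (at y)"
      by (auto intro!: derivative_eq_intros)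
    show ?thesis
      by (rule DERIV_cong[OF DERIV_mult[OF DERIV_mult[OF 1 2] 3]]) (use y in \<open>simp add: bg_kernel_def algebra_simps\<close>)
  qed
  have cont: "isCont ?f y" if y: "0 < y" for y
  proof -
    have "isCont (bg_kernel c m' q' x) y" for m' q'
    proof -
      have "isCont (\<lambda>y. y powr (m' - 1) * (x + y) powr (q' - 1) * exp (- (c * y))) y"
        using y assms by (intro continuous_intros) auto
      moreover have "\<forall>\<^sub>F z in nhds y. bg_kernel c m' q' x z = z powr (m' - 1) * (x + z) powr (q' - 1) * exp (- (c * z))"
        using eventually_nhds_in_open[of "{0<..}" y] y by (auto elim!: eventually_mono simp: bg_kernel_def)
      ultimately show ?thesis by (simp add: isCont_cong)
    qed
    then show ?thesis by (intro continuous_intros)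
  qed
  have "(LBINT y=0..\<infinity>. ?f y) = 0 - 0"
  proof (rule interval_integral_FTC_integrable)
    show "(?F has_vector_derivative ?f y) (at y)" if "0 < ereal y" for y
      using D[of y] that by (simp add: has_real_derivative_iff_has_vector_derivative zero_ereal_def)
    show "isCont ?f y" if "0 < ereal y" for y
      using cont[of y] that by (simp add: zero_ereal_def)
    have "integrable lborel ?f" using int by auto
    then show "set_integrable lborel (einterval 0 \<infinity>) ?f"
      unfolding set_integrable_def by (intro integrable_mult_indicator) auto
    have "((\<lambda>y. y powr (m - 1) * (x + y) powr (q - 1) * exp (- (c * y))) \<longlongrightarrow> 0 powr (m - 1) * (x + 0) powr (q - 1) * exp (- (c * 0))) (at_right 0)"
      using assms by (intro tendsto_intros) (auto intro!: eventually_mono[OF eventually_at_right_less])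
    then show "((?F \<circ> real_of_ereal) \<longlongrightarrow> 0) (at_right 0)"
      by (simp add: zero_ereal_def ereal_tendsto_simps)
    have "(?F \<longlongrightarrow> 0) at_top"
    proof -
      \<comment> \<open>The exponential is shared out in halves, one for the power of y and one for
        that of x + y. The constant \<open>exp (c / 2 * x)\<close> compensates for the
        shift.\<close>
      have lim: "((\<lambda>y::real. y powr r * exp (- (c / 2 * y))) \<longlongrightarrow> 0) at_top" for r
        using assms by real_asymp
      have shift: "filterlim (\<lambda>y. x + y) at_top at_top"
        by (rule filterlim_tendsto_add_at_top[OF tendsto_const filterlim_ident])
      have "((\<lambda>y. exp (c / 2 * x) * ((y powr (m - 1) * exp (- (c / 2 * y))) *
          ((x + y) powr (q - 1) * exp (- (c / 2 * (x + y)))))) \<longlongrightarrow> exp (c / 2 * x) * (0 * 0)) at_top"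
        by (intro tendsto_intros lim filterlim_compose[OF lim shift])
      also have "(\<lambda>y. exp (c / 2 * x) * ((y powr (m - 1) * exp (- (c / 2 * y))) *
          ((x + y) powr (q - 1) * exp (- (c / 2 * (x + y)))))) = ?F"
      proof
        fix y
        have "exp (c / 2 * x) * ((y powr (m - 1) * exp (- (c / 2 * y))) *
            ((x + y) powr (q - 1) * exp (- (c / 2 * (x + y)))))
          = y powr (m - 1) * (x + y) powr (q - 1) *
            (exp (c / 2 * x) * (exp (- (c / 2 * y)) * exp (- (c / 2 * (x + y)))))"
          by (simp only: mult_ac)
        also have "exp (c / 2 * x) * (exp (- (c / 2 * y)) * exp (- (c / 2 * (x + y)))) = exp (- (c * y))"
          by (simp add: exp_add[symmetric] algebra_simps)
        finally show "exp (c / 2 * x) * ((y powr (m - 1) * exp (- (c / 2 * y))) *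
          ((x + y) powr (q - 1) * exp (- (c / 2 * (x + y))))) = ?F y" .
      qed
      finally show ?thesis by simp
    qed
    then show "((?F \<circ> real_of_ereal) \<longlongrightarrow> 0) (at_left \<infinity>)"
      by (simp add: ereal_tendsto_simps)
  qed auto
  moreover have "(LBINT y=0..\<infinity>. ?f y) = (LBINT y. ?f y)"
    unfolding interval_lebesgue_integral_def set_lebesgue_integral_def
    by (auto intro!: Bochner_Integration.integral_cong simp: bg_kernel_def einterval_def indicator_def zero_ereal_def)
  ultimately show ?thesis using int by (simp add: bg_integral_def)
qed

text \<open>\<open>p\<close> may be any real number: \<open>rGamma\<close> is \<open>1/\<Gamma>\<close>, with value \<open>0\<close> at the poles of \<open>\<Gamma>\<close>, which is what keeps
  the derivative recursion valid there.\<close>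

definition bg_branch :: "real \<Rightarrow> real \<Rightarrow> real \<Rightarrow> real \<Rightarrow> real \<Rightarrow> real" where
  "bg_branch p a m b x = a powr p * b powr m * rGamma p * rGamma m * exp (- (a * x)) * bg_integral (a + b) m p x"

text \<open>The n-th derivative is a combination of branches with parameters p, p - 1, ..., p - n.
  Stated as a recursion it allows induction on n with p arbitrary.\<close>

primrec bg_deriv :: "nat \<Rightarrow> real \<Rightarrow> real \<Rightarrow> real \<Rightarrow> real \<Rightarrow> real \<Rightarrow> real" where
  "bg_deriv 0 p a m b x = bg_branch p a m b x"
| "bg_deriv (Suc n) p a m b x = a * (bg_deriv n (p - 1) a m b x - bg_deriv n p a m b x)"

lemma bg_deriv_0 [simp]: "bg_deriv 0 p a m b = bg_branch p a m b"
  by (rule ext) simp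

lemma rGamma_minus1: "(p - 1) * rGamma p = rGamma (p - 1)" for p :: real
  using rGamma_plus1[of "p - 1"] by simp

text \<open>The product rule, where the factor p - 1 from the integral is absorbed by
  \<open>rGamma p\<close> and one factor a is split off \<open>a powr p\<close>.\<close>

lemma DERIV_bg_branch:
  assumes "0 < m" "0 < a" "0 < b" "0 < x"
  shows "(bg_branch p a m b has_real_derivative a * (bg_branch (p - 1) a m b x - bg_branch p a m b x)) (at x)"
proof -
  have a: "a powr p = a * a powr (p - 1)"
    using assms by (simp add: powr_mult_base)
  have 1: "((\<lambda>x. exp (- (a * x))) has_real_derivative - a * exp (- (a * x))) (at x)"
    by (auto intro!: derivative_eq_intros)
  have 2: "(bg_integral (a + b) m p has_real_derivative (p - 1) * bg_integral (a + b) m (p - 1) x) (at x)"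
    using assms by (intro DERIV_bg_integral) auto
  show ?thesis
    unfolding bg_branch_def mult.assoc[of _ "exp _"]
    by (rule DERIV_cong[OF DERIV_cmult[OF DERIV_mult[OF 1 2]]])
      (simp add: rGamma_minus1[symmetric] a algebra_simps)
qed

lemma DERIV_bg_deriv:
  assumes "0 < m" "0 < a" "0 < b" "0 < x"
  shows "(bg_deriv n p a m b has_real_derivative bg_deriv (Suc n) p a m b x) (at x)"
proof (induction n arbitrary: p)
  case 0
  then show ?case using DERIV_bg_branch[OF assms] by simp
next
  case (Suc n)
  have "((\<lambda>x. a * (bg_deriv n (p - 1) a m b x - bg_deriv n p a m b x)) has_real_derivative
      a * (bg_deriv (Suc n) (p - 1) a m b x - bg_deriv (Suc n) p a m b x)) (at x)"
    by (intro DERIV_cmult DERIV_diff Suc)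
  then show ?case by simp
qed

text \<open>Integration by parts trades lowering p for lowering m. On the reflected branch, where
  the parameter pairs are interchanged, this is how the first parameter of the density gets
  lowered.\<close>

lemma bg_deriv_Suc_minus:
  assumes "1 < m" "0 < a" "0 < b" "0 < x"
  shows "bg_deriv (Suc n) p a m b x = b * (bg_deriv n p a m b x - bg_deriv n p a (m - 1) b x)"
proof (induction n arbitrary: p)
  case 0
  have a: "a powr p = a * a powr (p - 1)" and b: "b powr m = b * b powr (m - 1)"
    using assms by (simp_all add: powr_mult_base)
  define K where "K = a powr p * b powr m * rGamma p * rGamma m * exp (- (a * x))"
  have "bg_deriv (Suc 0) p a m b x
      = K * ((p - 1) * bg_integral (a + b) m (p - 1) x - a * bg_integral (a + b) m p x)"
    by (simp add: bg_branch_def K_def rGamma_minus1[symmetric] a algebra_simps)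
  also have "(p - 1) * bg_integral (a + b) m (p - 1) x
      = (a + b) * bg_integral (a + b) m p x - (m - 1) * bg_integral (a + b) (m - 1) p x"
    using bg_integral_parts[of m "a + b" x p] assms by simp
  also have "K * (\<dots> - a * bg_integral (a + b) m p x) = b * (bg_deriv 0 p a m b x - bg_deriv 0 p a (m - 1) b x)"
    by (simp add: bg_branch_def K_def rGamma_minus1[of m, symmetric] b algebra_simps)
  finally show ?case .
next
  case (Suc n)
  have "bg_deriv (Suc (Suc n)) p a m b x = a * (bg_deriv (Suc n) (p - 1) a m b x - bg_deriv (Suc n) p a m b x)"
    by (rule bg_deriv.simps(2))
  also have "\<dots> = a * (b * (bg_deriv n (p - 1) a m b x - bg_deriv n (p - 1) a (m - 1) b x)
      - b * (bg_deriv n p a m b x - bg_deriv n p a (m - 1) b x))"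
    by (simp only: Suc.IH)
  also have "\<dots> = b * (bg_deriv (Suc n) p a m b x - bg_deriv (Suc n) p a (m - 1) b x)"
    by (simp add: algebra_simps)
  finally show ?case .
qed

section \<open>Iterated derivatives of the density on the two half lines\<close>

lemma deriv_funpow_right:
  assumes D: "\<And>n x. 0 < x \<Longrightarrow> (g n has_real_derivative g (Suc n) x) (at x)"
    and f: "\<And>x. 0 < x \<Longrightarrow> f x = g 0 x" and x: "0 < x"
  shows "(deriv ^^ n) f x = g n x"
  using x
proof (induction n arbitrary: x)
  case 0
  then show ?case by (simp add: f)
next
  case (Suc n)
  have "\<forall>\<^sub>F z in nhds x. (deriv ^^ n) f z = g n z"
    using eventually_nhds_in_open[of "{0<..}" x] Suc by (auto elim!: eventually_mono)
  then have "deriv ((deriv ^^ n) f) x = deriv (g n) x"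
    by (rule deriv_cong_ev) simp
  also have "\<dots> = g (Suc n) x"
    using D Suc.prems by (intro DERIV_imp_deriv)
  finally show ?case by simp
qed

text \<open>Each derivative of a reflected function contributes a factor -1. An iterated derivative
  at a point only depends on values nearby, so formulas on the open half line suffice.\<close>

lemma deriv_funpow_left:
  assumes D: "\<And>n x. 0 < x \<Longrightarrow> (g n has_real_derivative g (Suc n) x) (at x)"
    and f: "\<And>x. 0 < x \<Longrightarrow> f (- x) = g 0 x" and x: "0 < x"
  shows "(deriv ^^ n) f (- x) = (-1) ^ n * g n x"
  using x
proof (induction n arbitrary: x)
  case 0
  then show ?case by (simp add: f)
next
  case (Suc n)
  have "\<forall>\<^sub>F z in nhds (- x). (deriv ^^ n) f z = (-1) ^ n * g n (- z)"
    using eventually_nhds_in_open[of "{..<0}" "- x"] Suc.prems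
  proof (auto elim!: eventually_mono)
    fix z :: real assume "z < 0"
    then show "(deriv ^^ n) f z = (-1) ^ n * g n (- z)" using Suc.IH[of "- z"] by simp
  qed
  then have "deriv ((deriv ^^ n) f) (- x) = deriv (\<lambda>z. (-1) ^ n * g n (- z)) (- x)"
    by (rule deriv_cong_ev) simp
  also have "((\<lambda>z. (-1) ^ n * g n (- z)) has_real_derivative (-1) ^ n * (g (Suc n) x * - 1)) (at (- x))"
  proof (intro DERIV_cmult DERIV_chain2[where f = "g n" and g = uminus])
    show "(g n has_real_derivative g (Suc n) x) (at (- (- x)))" using D[OF Suc.prems] by simp
  qed (auto intro!: derivative_eq_intros)
  then have "deriv (\<lambda>z. (-1) ^ n * g n (- z)) (- x) = (-1) ^ Suc n * g (Suc n) x"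
    by (simp add: DERIV_imp_deriv)
  finally show ?case by simp
qed

lemma bilateral_gamma_density_pos_eq:
  assumes "0 < p" "0 < a" "0 < m" "0 < b" "0 < x"
  shows "bilateral_gamma_density_pos p a m b x = bg_branch p a m b x"
proof -
  have "gamma_density p a (x + y) * gamma_density m b y
      = a powr p * b powr m * rGamma p * rGamma m * exp (- (a * x)) * bg_kernel (a + b) m p x y" for y
  proof (cases "0 < y")
    case True
    have "exp (- a * (x + y)) * exp (- b * y) = exp (- (a * x)) * exp (- ((a + b) * y))"
      by (simp add: exp_add[symmetric] algebra_simps)
    then show ?thesis using True assms
      by (simp add: gamma_density_def bg_kernel_def rGamma_inverse_Gamma divide_inverse mult_ac)
  qed (simp add: gamma_density_def bg_kernel_def)
  then show ?thesis
    using gamma_convolution_pos[OF assms] by (simp add: bg_branch_def bg_integral_def)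
qed

lemma deriv_bilateral_gamma_density:
  assumes "0 < p" "0 < a" "0 < m" "0 < b" "0 < x"
  shows "(deriv ^^ n) (bilateral_gamma_density p a m b) x = bg_deriv n p a m b x"
    and "(deriv ^^ n) (bilateral_gamma_density p a m b) (- x) = (-1) ^ n * bg_deriv n m b p a x"
proof -
  show "(deriv ^^ n) (bilateral_gamma_density p a m b) x = bg_deriv n p a m b x"
    by (rule deriv_funpow_right[where g = "\<lambda>n. bg_deriv n p a m b", OF DERIV_bg_deriv])
      (use assms in \<open>auto simp: bilateral_gamma_density_def bilateral_gamma_density_pos_eq\<close>)
  show "(deriv ^^ n) (bilateral_gamma_density p a m b) (- x) = (-1) ^ n * bg_deriv n m b p a x"
    by (rule deriv_funpow_left[where g = "\<lambda>n. bg_deriv n m b p a", OF DERIV_bg_deriv])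
      (use assms in \<open>auto simp: bilateral_gamma_density_def bilateral_gamma_density_pos_eq\<close>)
qed

section \<open>Behaviour at the origin\<close>

lemma exp_tendsto_1: "((\<lambda>x. exp (- (a * x))) \<longlongrightarrow> 1) (at_right 0)" for a :: real
  by (auto intro!: tendsto_eq_intros)

lemma bg_branch_tendsto_0:
  assumes "0 < m" "0 < a" "0 < b" "1 < p + m"
  shows "(bg_branch p a m b \<longlongrightarrow> a powr p * b powr m * rGamma p * rGamma m * (LBINT y. bg_kernel (a + b) m p 0 y)) (at_right 0)"
proof -
  have "((\<lambda>x. a powr p * b powr m * rGamma p * rGamma m * exp (- (a * x)) * bg_integral (a + b) m p x) \<longlongrightarrow>
     a powr p * b powr m * rGamma p * rGamma m * 1 * (LBINT y. bg_kernel (a + b) m p 0 y)) (at_right 0)"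
    using assms by (intro tendsto_mult tendsto_const exp_tendsto_1 bg_integral_tendsto_0) auto
  then show ?thesis unfolding bg_branch_def by simp
qed

text \<open>A differentiation lowers p by at most one, and the threshold for p + m rises by one with
  n; the branches reached therefore all have parameter sum above 1.\<close>

lemma bg_deriv_convergent:
  assumes "0 < m" "0 < a" "0 < b" "real n + 1 < p + m"
  shows "\<exists>L. (bg_deriv n p a m b \<longlongrightarrow> L) (at_right 0)"
  using assms(4)
proof (induction n arbitrary: p)
  case 0
  then show ?case using bg_branch_tendsto_0[OF assms(1-3), of p] by auto
next
  case (Suc n)
  from Suc.IH[of "p - 1"] Suc.IH[of p] Suc.prems obtain L L' where
    "(bg_deriv n (p - 1) a m b \<longlongrightarrow> L) (at_right 0)" "(bg_deriv n p a m b \<longlongrightarrow> L') (at_right 0)"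
    by auto
  then have "((\<lambda>x. a * (bg_deriv n (p - 1) a m b x - bg_deriv n p a m b x)) \<longlongrightarrow> a * (L - L')) (at_right 0)"
    by (intro tendsto_intros)
  then show ?case by auto
qed

text \<open>Lowering an integer p never meets a singular branch: for p \<ge> 1 the sum p + m exceeds
  1, and for p \<le> 0 the factor \<open>rGamma p\<close> makes the branch vanish
  identically.\<close>

lemma bg_deriv_convergent_Ints:
  assumes "0 < m" "0 < a" "0 < b" "p \<in> \<int>"
  shows "\<exists>L. (bg_deriv n p a m b \<longlongrightarrow> L) (at_right 0)"
  using assms(4)
proof (induction n arbitrary: p)
  case 0
  show ?case
  proof (cases "1 \<le> p")
    case True
    then show ?thesis using bg_deriv_convergent[OF assms(1-3), of 0 p] assms(1) by auto
  next
    case False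
    with 0 have "rGamma p = 0" by (auto simp: Ints_def rGamma_of_int)
    then show ?thesis by (auto simp: bg_branch_def)
  qed
next
  case (Suc n)
  from Suc.IH[of "p - 1"] Suc.IH[of p] Suc.prems obtain L L' where
    "(bg_deriv n (p - 1) a m b \<longlongrightarrow> L) (at_right 0)" "(bg_deriv n p a m b \<longlongrightarrow> L') (at_right 0)"
    by auto
  then have "((\<lambda>x. a * (bg_deriv n (p - 1) a m b x - bg_deriv n p a m b x)) \<longlongrightarrow> a * (L - L')) (at_right 0)"
    by (intro tendsto_intros)
  then show ?case by auto
qed

text \<open>Only the term with p lowered n times is singular. The exponent n + 1 - p - m is
  unchanged when n and p drop together, and the remaining term is bounded near 0 against a positive
  power of x. The sine is the reflection formula at p - n.\<close>

lemma bg_deriv_singular: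
  assumes "0 < m" "0 < a" "0 < b" "real n < p + m" "p + m < real n + 1"
  shows "((\<lambda>x. x powr (real n + 1 - p - m) * bg_deriv n p a m b x) \<longlongrightarrow>
    a powr p * b powr m * Gamma (real n + 1 - p - m) * sin (pi * (p - n)) / pi) (at_right 0)"
  using assms(4,5)
proof (induction n arbitrary: p)
  case 0
  have "((\<lambda>x. a powr p * b powr m * rGamma p * rGamma m * exp (- (a * x)) * (x powr (1 - m - p) * bg_integral (a + b) m p x)) \<longlongrightarrow>
     a powr p * b powr m * rGamma p * rGamma m * 1 * (Gamma m * Gamma (1 - m - p) * rGamma (1 - p))) (at_right 0)"
    using assms 0 by (intro tendsto_mult tendsto_const exp_tendsto_1 bg_integral_singular) auto
  moreover have "a powr p * b powr m * rGamma p * rGamma m * 1 * (Gamma m * Gamma (1 - m - p) * rGamma (1 - p))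
     = a powr p * b powr m * Gamma (1 - p - m) * (rGamma p * rGamma (1 - p))"
    using Gamma_real_pos[OF assms(1)] by (simp add: rGamma_inverse_Gamma[of m] algebra_simps)
  ultimately show ?case
    unfolding rGamma_reflection_real by (simp add: bg_branch_def algebra_simps)
next
  case (Suc n)
  let ?\<alpha> = "real (Suc n) + 1 - p - m"
  obtain L where L: "(bg_deriv n p a m b \<longlongrightarrow> L) (at_right 0)"
    using bg_deriv_convergent[OF assms(1-3), of n p] Suc.prems by auto
  have "((\<lambda>x. x powr ?\<alpha> * bg_deriv n (p - 1) a m b x) \<longlongrightarrow>
    a powr (p - 1) * b powr m * Gamma ?\<alpha> * sin (pi * (p - Suc n)) / pi) (at_right 0)"
    using Suc.IH[of "p - 1"] Suc.prems by (simp add: algebra_simps)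
  moreover have "((\<lambda>x::real. x powr ?\<alpha>) \<longlongrightarrow> 0) (at_right 0)"
    using Suc.prems by real_asymp
  ultimately have "((\<lambda>x. a * (x powr ?\<alpha> * bg_deriv n (p - 1) a m b x - x powr ?\<alpha> * bg_deriv n p a m b x)) \<longlongrightarrow>
    a * (a powr (p - 1) * b powr m * Gamma ?\<alpha> * sin (pi * (p - Suc n)) / pi - 0 * L)) (at_right 0)"
    using L by (intro tendsto_intros)
  moreover have "a powr p = a * a powr (p - 1)"
    using assms by (simp add: powr_mult_base)
  ultimately show ?case by (simp add: algebra_simps)
qed

text \<open>The same induction with the logarithm as gauge. The sine is expressed through m, which
  stays fixed while p is lowered.\<close>

lemma bg_deriv_log:
  assumes "0 < m" "0 < a" "0 < b" "p + m = real n + 1"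
  shows "((\<lambda>x. bg_deriv n p a m b x / ln (1 / x)) \<longlongrightarrow> a powr p * b powr m * sin (pi * m) / pi) (at_right 0)"
  using assms(4)
proof (induction n arbitrary: p)
  case 0
  then have p: "p = 1 - m" by simp
  have "((\<lambda>x. a powr p * b powr m * rGamma p * rGamma m * exp (- (a * x)) * (bg_integral (a + b) m (1 - m) x / ln (1 / x))) \<longlongrightarrow>
     a powr p * b powr m * rGamma p * rGamma m * 1 * 1) (at_right 0)"
    using assms by (intro tendsto_mult tendsto_const exp_tendsto_1 bg_integral_log) auto
  then show ?case
    using rGamma_reflection_real[of m] by (simp add: bg_branch_def p mult.assoc mult.commute[of "rGamma (1 - m)"])
next
  case (Suc n)
  obtain L where L: "(bg_deriv n p a m b \<longlongrightarrow> L) (at_right 0)"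
    using bg_deriv_convergent[OF assms(1-3), of n p] Suc.prems by auto
  have "filterlim (\<lambda>x::real. ln (1 / x)) at_infinity (at_right 0)"
    by real_asymp
  with L have "((\<lambda>x. bg_deriv n p a m b x / ln (1 / x)) \<longlongrightarrow> 0) (at_right 0)"
    by (rule tendsto_divide_0)
  moreover have "((\<lambda>x. bg_deriv n (p - 1) a m b x / ln (1 / x)) \<longlongrightarrow> a powr (p - 1) * b powr m * sin (pi * m) / pi) (at_right 0)"
    using Suc by simp
  ultimately have "((\<lambda>x. a * (bg_deriv n (p - 1) a m b x / ln (1 / x) - bg_deriv n p a m b x / ln (1 / x))) \<longlongrightarrow>
    a * (a powr (p - 1) * b powr m * sin (pi * m) / pi - 0)) (at_right 0)"
    by (intro tendsto_mult_left tendsto_diff)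
  moreover have "a powr p = a * a powr (p - 1)"
    using assms by (simp add: powr_mult_base)
  ultimately show ?case by (simp add: diff_divide_distrib[symmetric] mult.assoc)
qed

section \<open>The jump of the derivatives across the origin\<close>

text \<open>For \<open>x > 0\<close> this is \<open>f\<^sup>(\<^sup>n\<^sup>)(x) - f\<^sup>(\<^sup>n\<^sup>)(-x)\<close>, as \<open>f\<close> has the interchanged parameters at \<open>-x\<close>.\<close>

definition bg_jump :: "nat \<Rightarrow> real \<Rightarrow> real \<Rightarrow> real \<Rightarrow> real \<Rightarrow> real \<Rightarrow> real" where
  "bg_jump n p a m b x = bg_deriv n p a m b x - (-1) ^ n * bg_deriv n m b p a x"

text \<open>The right branch lowers p by definition, the reflected one by integration by parts,
  which requires p > 1. The sign in the latter rule matches the extra factor -1 from the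
  reflection.\<close>

lemma bg_jump_Suc_plus:
  assumes "1 < p" "0 < a" "0 < b" "0 < x"
  shows "bg_jump (Suc n) p a m b x = a * (bg_jump n (p - 1) a m b x - bg_jump n p a m b x)"
proof -
  have "bg_deriv (Suc n) m b p a x = a * (bg_deriv n m b p a x - bg_deriv n m b (p - 1) a x)"
    using bg_deriv_Suc_minus assms by blast
  then show ?thesis
    unfolding bg_jump_def bg_deriv.simps(2)[of n p a m b x] by (simp only:) (simp add: algebra_simps)
qed

lemma bg_jump_Suc_minus:
  assumes "1 < m" "0 < a" "0 < b" "0 < x"
  shows "bg_jump (Suc n) p a m b x = b * (bg_jump n p a m b x - bg_jump n p a (m - 1) b x)"
  unfolding bg_jump_def bg_deriv_Suc_minus[OF assms] by (simp add: algebra_simps)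

text \<open>At n = 0 both branches have the same limit, since the kernel at 0 depends only on p + m
  and a + b. In the induction step p + m > 2, so at least one parameter exceeds 1 and can be
  lowered.\<close>

lemma bg_jump_tendsto_0:
  assumes "0 < p" "0 < a" "0 < m" "0 < b" "real n + 1 < p + m"
  shows "(bg_jump n p a m b \<longlongrightarrow> 0) (at_right 0)"
  using assms(1,3,5)
proof (induction n arbitrary: p m)
  case 0
  have "(LBINT y. bg_kernel (a + b) m p 0 y) = (LBINT y. bg_kernel (b + a) p m 0 y)"
    unfolding bg_kernel_0 by (simp add: add.commute)
  then show ?case
    using tendsto_diff[OF bg_branch_tendsto_0[of m a b p] bg_branch_tendsto_0[of p b a m]] 0 assms
    by (simp add: bg_jump_def mult_ac add.commute)
next
  case (Suc n)
  consider "1 < p" | "1 < m" using Suc.prems by fastforce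
  then show ?case
  proof cases
    case 1
    have "((\<lambda>x. a * (bg_jump n (p - 1) a m b x - bg_jump n p a m b x)) \<longlongrightarrow> a * (0 - 0)) (at_right 0)"
      using Suc 1 by (intro tendsto_intros Suc.IH) auto
    moreover have "\<forall>\<^sub>F x in at_right 0. a * (bg_jump n (p - 1) a m b x - bg_jump n p a m b x) = bg_jump (Suc n) p a m b x"
      using eventually_at_right_less[of "0::real"] by eventually_elim (use 1 assms in \<open>simp add: bg_jump_Suc_plus\<close>)
    ultimately show ?thesis by (simp add: Lim_transform_eventually)
  next
    case 2
    have "((\<lambda>x. b * (bg_jump n p a m b x - bg_jump n p a (m - 1) b x)) \<longlongrightarrow> b * (0 - 0)) (at_right 0)"
      using Suc 2 by (intro tendsto_intros Suc.IH) auto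
    moreover have "\<forall>\<^sub>F x in at_right 0. b * (bg_jump n p a m b x - bg_jump n p a (m - 1) b x) = bg_jump (Suc n) p a m b x"
      using eventually_at_right_less[of "0::real"] by eventually_elim (use 2 assms in \<open>simp add: bg_jump_Suc_minus\<close>)
    ultimately show ?thesis by (simp add: Lim_transform_eventually)
  qed
qed

lemma bg_jump_critical_0:
  assumes "0 < p" "0 < a" "0 < m" "0 < b" "p + m = 1"
  shows "(bg_jump 0 p a m b \<longlongrightarrow> a powr p * b powr m * cos (pi * m)) (at_right 0)"
proof -
  have p: "p = 1 - m" and m: "m < 1" using assms by auto
  let ?c = "a + b" and ?K = "a powr p * b powr m * rGamma p * rGamma m"
  have log: "((\<lambda>x. bg_integral ?c (1 - m) (1 - (1 - m)) x / ln (1 / x)) \<longlongrightarrow> 1) (at_right 0)"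
    using assms m by (intro bg_integral_log) auto
  have eps: "((\<lambda>x. (exp (- (a * x)) - exp (- (b * x))) * ln (1 / x)) \<longlongrightarrow> 0) (at_right 0)"
    by real_asymp
  have gap: "((\<lambda>x. exp (- (a * x)) * (bg_integral ?c m (1 - m) x - bg_integral ?c (1 - m) m x)) \<longlongrightarrow>
     1 * (Gamma m * Gamma (1 - m) * cos (pi * m))) (at_right 0)"
    using assms m by (intro tendsto_mult exp_tendsto_1 bg_integral_gap) auto
  \<comment> \<open>The two branches carry different exponentials. Giving both the factor exp (-a x)
    produces the gap and an error, namely an O(x) difference of exponentials times an integral of
    logarithmic size.\<close>
  have "((\<lambda>x. ?K * (exp (- (a * x)) * (bg_integral ?c m (1 - m) x - bg_integral ?c (1 - m) m x) +
      ((exp (- (a * x)) - exp (- (b * x))) * ln (1 / x)) * (bg_integral ?c (1 - m) (1 - (1 - m)) x / ln (1 / x)))) \<longlongrightarrow>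
      ?K * (1 * (Gamma m * Gamma (1 - m) * cos (pi * m)) + 0 * 1)) (at_right 0)"
    by (rule tendsto_mult_left[OF tendsto_add[OF gap tendsto_mult[OF eps log]]])
  also have "?K * (1 * (Gamma m * Gamma (1 - m) * cos (pi * m)) + 0 * 1) = a powr p * b powr m * cos (pi * m)"
    using assms m Gamma_real_nonzero[of m] Gamma_real_nonzero[of "1 - m"] by (simp add: p rGamma_inverse_Gamma field_simps)
  finally show ?thesis
  proof (rule Lim_transform_eventually)
    show "\<forall>\<^sub>F x in at_right 0. ?K * (exp (- (a * x)) * (bg_integral ?c m (1 - m) x - bg_integral ?c (1 - m) m x) +
      ((exp (- (a * x)) - exp (- (b * x))) * ln (1 / x)) * (bg_integral ?c (1 - m) (1 - (1 - m)) x / ln (1 / x)))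
      = bg_jump 0 p a m b x"
      using eventually_at_right_real[of 0 1, simplified]
    proof eventually_elim
      case (elim x)
      \<comment> \<open>The logarithm is inserted and cancelled, hence the restriction to 0 < x <
        1.\<close>
      then have "ln (1 / x) \<noteq> 0" by (simp add: ln_div)
      then show ?case by (simp add: bg_jump_def bg_branch_def p algebra_simps)
    qed
  qed
qed

text \<open>Of the two terms in the recursion one is the critical jump for n and the other tends to
  0. Lowering m flips the sign of cos (pi m), which the sign in the recursion undoes. As p + m \<ge>
  2, no parameter could be lowered only if p = m = 1, and p is not an integer.\<close>

lemma bg_jump_critical:
  assumes "0 < p" "0 < a" "0 < m" "0 < b" "p + m = real n + 1" "p \<notin> \<int>"
  shows "(bg_jump n p a m b \<longlongrightarrow> a powr p * b powr m * cos (pi * m)) (at_right 0)"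
  using assms(1,3,5,6)
proof (induction n arbitrary: p m)
  case 0
  then show ?case using bg_jump_critical_0[of p a m b] assms by simp
next
  case (Suc n)
  have zero: "(bg_jump n p a m b \<longlongrightarrow> 0) (at_right 0)"
    using Suc.prems assms by (intro bg_jump_tendsto_0) auto
  consider "1 < p" | "1 < m" | "p = 1" "m = 1" using Suc.prems by fastforce
  then show ?case
  proof cases
    case 1
    have "((\<lambda>x. a * (bg_jump n (p - 1) a m b x - bg_jump n p a m b x)) \<longlongrightarrow>
        a * (a powr (p - 1) * b powr m * cos (pi * m) - 0)) (at_right 0)"
      using Suc.prems 1 zero by (intro tendsto_intros Suc.IH) auto
    moreover have "\<forall>\<^sub>F x in at_right 0. a * (bg_jump n (p - 1) a m b x - bg_jump n p a m b x) = bg_jump (Suc n) p a m b x"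
      using eventually_at_right_less[of "0::real"] by eventually_elim (use 1 assms in \<open>simp add: bg_jump_Suc_plus\<close>)
    moreover have "a powr p = a * a powr (p - 1)"
      using assms by (simp add: powr_mult_base)
    ultimately show ?thesis by (simp add: Lim_transform_eventually mult.assoc)
  next
    case 2
    have "((\<lambda>x. b * (bg_jump n p a m b x - bg_jump n p a (m - 1) b x)) \<longlongrightarrow>
        b * (0 - a powr p * b powr (m - 1) * cos (pi * (m - 1)))) (at_right 0)"
      using Suc.prems 2 zero by (intro tendsto_intros Suc.IH) auto
    moreover have "\<forall>\<^sub>F x in at_right 0. b * (bg_jump n p a m b x - bg_jump n p a (m - 1) b x) = bg_jump (Suc n) p a m b x"
      using eventually_at_right_less[of "0::real"] by eventually_elim (use 2 assms in \<open>simp add: bg_jump_Suc_minus\<close>)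
    moreover have "b powr m = b * b powr (m - 1)"
      using assms by (simp add: powr_mult_base)
    moreover have "cos (pi * (m - 1)) = - cos (pi * m)"
      by (simp add: right_diff_distrib cos_diff)
    ultimately show ?thesis by (simp add: Lim_transform_eventually mult_ac)
  next
    case 3
    with Suc.prems show ?thesis by simp
  qed
qed

section \<open>The comparison function K ln (1/|x|) and the sign of its constant\<close>

lemma slowly_varying_ln:
  assumes "K \<noteq> 0"
  shows "slowly_varying_at_0 (\<lambda>x. K * ln (1 / \<bar>x\<bar>))"
  unfolding slowly_varying_at_0_def
proof (intro allI impI)
  fix c :: real assume c: "0 < c"
  have "((\<lambda>x. ln (1 / (c * x)) / ln (1 / x)) \<longlongrightarrow> 1) (at_right 0)"
    using c by real_asymp
  moreover have "\<forall>\<^sub>F x in at_right 0. ln (1 / (c * x)) / ln (1 / x) = K * ln (1 / \<bar>c * x\<bar>) / (K * ln (1 / \<bar>x\<bar>))"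
    using eventually_at_right_less[of "0::real"] by eventually_elim (use assms c in simp)
  ultimately have "((\<lambda>x. K * ln (1 / \<bar>c * x\<bar>) / (K * ln (1 / \<bar>x\<bar>))) \<longlongrightarrow> 1) (at_right 0)"
    by (rule Lim_transform_eventually)
  then show "((\<lambda>x. K * ln (1 / \<bar>c * x\<bar>) / (K * ln (1 / \<bar>x\<bar>))) \<longlongrightarrow> 1) (at 0)"
    by (auto intro!: filterlim_split_at simp: filterlim_at_left_to_right abs_mult assms)
qed

lemma filterlim_ln_inverse_abs: "filterlim (\<lambda>x::real. ln (1 / \<bar>x\<bar>)) at_top (at 0)"
proof -
  have "filterlim (\<lambda>x::real. ln (1 / \<bar>x\<bar>)) at_top (at_right 0)" by real_asymp
  then show ?thesis
    by (auto intro!: filterlim_split_at simp: filterlim_at_left_to_right)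
qed

text \<open>The sine is positive at pi times the fractional part, and each shift by pi changes its
  sign. This decides whether the comparison function tends to plus or to minus infinity.\<close>

lemma sin_pi_sign:
  fixes m :: real
  assumes "m \<notin> \<int>"
  shows "if even \<lfloor>m\<rfloor> then 0 < sin (pi * m) else sin (pi * m) < 0"
proof -
  define r where "r = m - of_int \<lfloor>m\<rfloor>"
  have "r \<noteq> 0" using assms by (metis Ints_of_int eq_iff_diff_eq_0 r_def)
  moreover have "0 \<le> r" "r < 1" unfolding r_def by linarith+
  ultimately have r: "0 < sin (pi * r)" by (intro sin_gt_zero) auto
  have m: "pi * m = pi * r + of_int \<lfloor>m\<rfloor> * pi" by (simp add: r_def algebra_simps)
  show ?thesis
  proof (cases "even \<lfloor>m\<rfloor>")
    case True
    then obtain k where k: "\<lfloor>m\<rfloor> = 2 * k" by blast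
    have "sin (pi * m) = sin (pi * r)"
      unfolding m k using sin_integer_2pi[of "of_int k"] cos_integer_2pi[of "of_int k"]
      by (simp add: sin_add mult_ac)
    with True r show ?thesis by simp
  next
    case False
    then obtain k where k: "\<lfloor>m\<rfloor> = 2 * k + 1" using oddE by blast
    have "pi * m = (pi * r + 2 * pi * of_int k) + pi"
      unfolding m k by (simp add: algebra_simps)
    then have "sin (pi * m) = - sin (pi * r + 2 * pi * of_int k)"
      by (simp only: sin_periodic_pi)
    also have "\<dots> = - sin (pi * r)"
      using sin_integer_2pi[of "of_int k"] cos_integer_2pi[of "of_int k"] by (simp add: sin_add)
    finally have "sin (pi * m) = - sin (pi * r)" .
    with False r show ?thesis by simp
  qed
qed

lemma sin_pi_nonzero: "sin (pi * x) \<noteq> 0" if "x \<notin> \<int>" for x :: real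
  using sin_pi_sign[OF that] by (auto split: if_splits)

section \<open>Combination of the limits at the origin into the three claims\<close>

theorem theorem6p1:
  fixes \<alpha>p lp \<alpha>m lm :: real and f :: "real \<Rightarrow> real" and N :: nat
  assumes "0 < \<alpha>p" and "0 < lp" and "0 < \<alpha>m" and "0 < lm"
    and "f = bilateral_gamma_density \<alpha>p lp \<alpha>m lm"
    and "N = nat (\<lceil>\<alpha>p + \<alpha>m\<rceil> - 1)"
  shows
    "((\<exists>L. ((deriv ^^ N) f \<longlongrightarrow> L) (at_right 0)) \<longleftrightarrow> \<alpha>p \<in> \<nat>) \<and>
     (\<alpha>p \<notin> \<nat> \<and> \<alpha>p + \<alpha>m \<notin> \<nat> \<longrightarrow>
       (let \<alpha> = real N + 1 - \<alpha>p - \<alpha>m;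
            C1 = lp powr \<alpha>p * lm powr \<alpha>m * sin (\<alpha>p * pi) /
                   (Gamma (\<alpha>p + \<alpha>m - real N) * sin ((\<alpha>p + \<alpha>m) * pi))
        in C1 \<noteq> 0 \<and> 0 < \<alpha> \<and> \<alpha> < 1 \<and> (deriv ^^ N) f \<sim>[at_right 0] (\<lambda>x. C1 / x powr \<alpha>))) \<and>
     (\<alpha>p \<notin> \<nat> \<and> \<alpha>p + \<alpha>m \<in> \<nat> \<longrightarrow>
       (\<exists>M. slowly_varying_at_0 M \<and>
            filterlim M (if even \<lfloor>\<alpha>m\<rfloor> then at_top else at_bot) (at 0) \<and>
            (deriv ^^ N) f \<sim>[at 0] M) \<and>
       (let C2 = lp powr \<alpha>p * lm powr \<alpha>m / 2 *
                   ((-1) ^ (N + 1) * cos (\<alpha>p * pi) + cos (\<alpha>m * pi))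
        in ((\<lambda>x. (deriv ^^ N) f x - (deriv ^^ N) f (- x)) \<longlongrightarrow> C2) (at_right 0)))"
proof -
  note pos = assms(1-4)
  define g where "g = (deriv ^^ N) f"
  define A where "A = lp powr \<alpha>p * lm powr \<alpha>m"
  have A: "0 < A" using pos by (simp add: A_def)
  have g_right: "g x = bg_deriv N \<alpha>p lp \<alpha>m lm x"
    and g_left: "g (- x) = (-1) ^ N * bg_deriv N \<alpha>m lm \<alpha>p lp x" if "0 < x" for x
    unfolding g_def assms(5) using deriv_bilateral_gamma_density[OF pos that] by simp_all
  have ev_pos: "\<forall>\<^sub>F x in at_right (0::real). 0 < x" by (rule eventually_at_right_less)
  have g_iff: "(g \<longlongrightarrow> L) (at_right 0) \<longleftrightarrow> (bg_deriv N \<alpha>p lp \<alpha>m lm \<longlongrightarrow> L) (at_right 0)" for L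
    by (rule tendsto_cong) (use ev_pos in \<open>eventually_elim, simp add: g_right\<close>)
  have ints: "x \<in> \<int> \<longleftrightarrow> x \<in> \<nat>" if "0 < x" for x :: real
    using that by (auto simp: Nats_altdef2)
  \<comment> \<open>\<open>nat\<close> truncates nothing here, so the sum of the parameters lies in
    the half-open interval (N, N + 1]; the right end is the integer case.\<close>
  have "\<lceil>\<alpha>p + \<alpha>m\<rceil> \<ge> 1" using pos by simp
  then have "\<lceil>\<alpha>p + \<alpha>m\<rceil> = int N + 1" using assms(6) by simp
  then have N: "real N < \<alpha>p + \<alpha>m" "\<alpha>p + \<alpha>m \<le> real N + 1" by linarith+
  have N_Nats: "\<alpha>p + \<alpha>m \<in> \<nat> \<longleftrightarrow> \<alpha>p + \<alpha>m = real N + 1"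
  proof
    assume "\<alpha>p + \<alpha>m \<in> \<nat>"
    then obtain k where "\<alpha>p + \<alpha>m = real k" by (auto elim: Nats_cases)
    with N show "\<alpha>p + \<alpha>m = real N + 1" by simp
  next
    assume "\<alpha>p + \<alpha>m = real N + 1"
    then show "\<alpha>p + \<alpha>m \<in> \<nat>" by (metis of_nat_Suc of_nat_in_Nats add.commute)
  qed

  let ?\<alpha> = "real N + 1 - \<alpha>p - \<alpha>m"
  let ?C1 = "lp powr \<alpha>p * lm powr \<alpha>m * sin (\<alpha>p * pi) /
                   (Gamma (\<alpha>p + \<alpha>m - real N) * sin ((\<alpha>p + \<alpha>m) * pi))"
  have singular: "?C1 \<noteq> 0 \<and> 0 < ?\<alpha> \<and> ?\<alpha> < 1 \<and> ((\<lambda>x. x powr ?\<alpha> * g x) \<longlongrightarrow> ?C1) (at_right 0)"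
    if "\<alpha>p \<notin> \<nat>" "\<alpha>p + \<alpha>m \<notin> \<nat>"
  proof -
    have lt: "\<alpha>p + \<alpha>m < real N + 1" using N N_Nats that(2) by linarith
    have nz: "sin (pi * \<alpha>p) \<noteq> 0" "sin (pi * (\<alpha>p + \<alpha>m)) \<noteq> 0"
      using that ints[of \<alpha>p] ints[of "\<alpha>p + \<alpha>m"] pos by (auto intro!: sin_pi_nonzero)
    \<comment> \<open>The limit constant contains \<open>Gamma (1 - s)\<close>, whereas C1 has
      \<open>Gamma s\<close> in the denominator; reflection converts one into the other. The signs
      (-1)^N from the two shifted sines cancel.\<close>
    define s where "s = \<alpha>p + \<alpha>m - N"
    have s: "0 < s" "s < 1" using lt N by (auto simp: s_def)
    have shift: "sin (pi * (y - real N)) = (-1) ^ N * sin (pi * y)" for y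
      by (simp add: right_diff_distrib sin_diff mult.commute[of pi "real N"])
    have "Gamma (1 - s) * sin (pi * s) / pi = rGamma s"
      using rGamma_reflection_real[of s] s Gamma_real_nonzero[of "1 - s"]
      by (simp add: rGamma_inverse_Gamma[of "1 - s"] field_simps)
    then have "Gamma (1 - s) * (sin (pi * s) * Gamma s) = pi"
      using Gamma_real_nonzero[OF s(1)] by (simp add: rGamma_inverse_Gamma field_simps)
    moreover have "sin (pi * s) = (-1) ^ N * sin (pi * (\<alpha>p + \<alpha>m))"
      unfolding s_def by (rule shift)
    ultimately have eq: "Gamma (1 - s) * ((-1) ^ N * sin (pi * (\<alpha>p + \<alpha>m)) * Gamma s) = pi"
      by (simp only:)
    have sq: "(-1) ^ N * (-1) ^ N = (1 :: real)"
      by (simp flip: power_mult_distrib)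
    have Gamma_s: "Gamma s \<noteq> 0" using s by (intro Gamma_real_nonzero)
    have "Gamma (1 - s) * (Gamma s * sin (pi * (\<alpha>p + \<alpha>m))) * ((-1) ^ N * (-1) ^ N)
        = Gamma (1 - s) * ((-1) ^ N * sin (pi * (\<alpha>p + \<alpha>m)) * Gamma s) * (-1) ^ N"
      by (simp only: mult_ac)
    also have "\<dots> = pi * (-1) ^ N" by (simp only: eq)
    finally have Gs: "Gamma (1 - s) = pi * (-1) ^ N / (Gamma s * sin (pi * (\<alpha>p + \<alpha>m)))"
      using nz Gamma_s unfolding sq by (subst eq_divide_eq) simp
    have "((\<lambda>x. x powr ?\<alpha> * bg_deriv N \<alpha>p lp \<alpha>m lm x) \<longlongrightarrow>
      A * Gamma ?\<alpha> * sin (pi * (\<alpha>p - real N)) / pi) (at_right 0)"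
      unfolding A_def using pos N lt by (intro bg_deriv_singular) auto
    also have "A * Gamma ?\<alpha> * sin (pi * (\<alpha>p - real N)) / pi = ?C1"
    proof -
      have \<alpha>: "?\<alpha> = 1 - s" by (simp add: s_def)
      have "A * Gamma ?\<alpha> * sin (pi * (\<alpha>p - real N)) / pi
          = ((-1) ^ N * (-1) ^ N) * (A * sin (pi * \<alpha>p) / (Gamma s * sin (pi * (\<alpha>p + \<alpha>m))))"
        unfolding \<alpha> Gs shift by simp
      then show ?thesis by (simp only: sq A_def s_def mult_1 mult.commute[of pi])
    qed
    finally have "((\<lambda>x. x powr ?\<alpha> * bg_deriv N \<alpha>p lp \<alpha>m lm x) \<longlongrightarrow> ?C1) (at_right 0)" .
    moreover have "((\<lambda>x. x powr ?\<alpha> * g x) \<longlongrightarrow> ?C1) (at_right 0) \<longleftrightarrow>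
        ((\<lambda>x. x powr ?\<alpha> * bg_deriv N \<alpha>p lp \<alpha>m lm x) \<longlongrightarrow> ?C1) (at_right 0)"
      by (rule tendsto_cong) (use ev_pos in \<open>eventually_elim, simp add: g_right\<close>)
    moreover have "?C1 \<noteq> 0"
      using nz A Gamma_s pos by (simp add: A_def s_def mult.commute)
    ultimately show ?thesis using lt N by auto
  qed

  \<comment> \<open>The common logarithmic coefficient of both sides. On the left sin (pi \<alpha>p)
    = (-1)^N sin (pi \<alpha>m) appears, and its sign cancels that of the reflection.\<close>
  define K where "K = A * sin (pi * \<alpha>m) / pi"
  have critical: "K \<noteq> 0 \<and> ((\<lambda>x. g x / ln (1 / x)) \<longlongrightarrow> K) (at_right 0) \<and>
      ((\<lambda>x. g (- x) / ln (1 / x)) \<longlongrightarrow> K) (at_right 0)"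
    if "\<alpha>p \<notin> \<nat>" "\<alpha>p + \<alpha>m \<in> \<nat>"
  proof -
    have eq: "\<alpha>p + \<alpha>m = real N + 1" using that N_Nats by simp
    then have p: "\<alpha>p = real (Suc N) - \<alpha>m" by simp
    have sin_p: "sin (pi * \<alpha>p) = (-1) ^ N * sin (pi * \<alpha>m)"
      unfolding p by (simp only: right_diff_distrib sin_diff mult.commute[of pi "real _"] sin_npi cos_npi) simp
    have "sin (pi * \<alpha>p) \<noteq> 0" using that ints pos by (auto intro!: sin_pi_nonzero)
    then have "K \<noteq> 0" using A sin_p by (simp add: K_def)
    moreover have "((\<lambda>x. bg_deriv N \<alpha>p lp \<alpha>m lm x / ln (1 / x)) \<longlongrightarrow> K) (at_right 0)"
      unfolding K_def A_def using pos eq by (intro bg_deriv_log) auto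
    then have "((\<lambda>x. g x / ln (1 / x)) \<longlongrightarrow> K) (at_right 0)"
      by (rule Lim_transform_eventually) (use ev_pos in \<open>eventually_elim, simp add: g_right\<close>)
    moreover have "((\<lambda>x. bg_deriv N \<alpha>m lm \<alpha>p lp x / ln (1 / x)) \<longlongrightarrow>
        lm powr \<alpha>m * lp powr \<alpha>p * sin (pi * \<alpha>p) / pi) (at_right 0)"
      using pos eq by (intro bg_deriv_log) auto
    then have "((\<lambda>x. (-1) ^ N * (bg_deriv N \<alpha>m lm \<alpha>p lp x / ln (1 / x))) \<longlongrightarrow>
        (-1) ^ N * (lm powr \<alpha>m * lp powr \<alpha>p * sin (pi * \<alpha>p) / pi)) (at_right 0)"
      by (rule tendsto_mult_left)
    then have "((\<lambda>x. g (- x) / ln (1 / x)) \<longlongrightarrow>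
        (-1) ^ N * (lm powr \<alpha>m * lp powr \<alpha>p * sin (pi * \<alpha>p) / pi)) (at_right 0)"
      by (rule Lim_transform_eventually) (use ev_pos in \<open>eventually_elim, simp add: g_left\<close>)
    moreover have "(-1) ^ N * (lm powr \<alpha>m * lp powr \<alpha>p * sin (pi * \<alpha>p) / pi) = K"
      unfolding sin_p K_def A_def by (simp add: mult_ac power_add[symmetric] flip: mult_2)
    ultimately show ?thesis by simp
  qed

  have part1: "(\<exists>L. (g \<longlongrightarrow> L) (at_right 0)) \<longleftrightarrow> \<alpha>p \<in> \<nat>"
  proof
    assume "\<alpha>p \<in> \<nat>"
    then show "\<exists>L. (g \<longlongrightarrow> L) (at_right 0)"
      unfolding g_iff using pos ints by (intro bg_deriv_convergent_Ints) auto
  next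
    assume "\<exists>L. (g \<longlongrightarrow> L) (at_right 0)"
    then obtain L where L: "(g \<longlongrightarrow> L) (at_right 0)" by blast
    show "\<alpha>p \<in> \<nat>"
    \<comment> \<open>A finite limit would send the normalised derivative, divided by the logarithm
      or multiplied by a positive power of x, to 0. Its actual limit is the nonzero \<open>K\<close>
      or C1.\<close>
    proof (rule ccontr)
      assume p: "\<alpha>p \<notin> \<nat>"
      show False
      proof (cases "\<alpha>p + \<alpha>m \<in> \<nat>")
        case True
        have "filterlim (\<lambda>x::real. ln (1 / x)) at_infinity (at_right 0)" by real_asymp
        with L have "((\<lambda>x. g x / ln (1 / x)) \<longlongrightarrow> 0) (at_right 0)" by (rule tendsto_divide_0)
        with critical[OF p True] show False
          using tendsto_unique[OF trivial_limit_at_right_real] by blast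
      next
        case False
        note s = singular[OF p False]
        then have "((\<lambda>x::real. x powr ?\<alpha>) \<longlongrightarrow> 0) (at_right 0)" by real_asymp
        then have lim: "((\<lambda>x. x powr ?\<alpha> * g x) \<longlongrightarrow> 0 * L) (at_right 0)" using L by (rule tendsto_mult)
        from s have "((\<lambda>x. x powr ?\<alpha> * g x) \<longlongrightarrow> ?C1) (at_right 0)" by blast
        from tendsto_unique[OF trivial_limit_at_right_real this lim] s show False by simp
      qed
    qed
  qed

  have part2: "?C1 \<noteq> 0 \<and> 0 < ?\<alpha> \<and> ?\<alpha> < 1 \<and> g \<sim>[at_right 0] (\<lambda>x. ?C1 / x powr ?\<alpha>)"
    if "\<alpha>p \<notin> \<nat> \<and> \<alpha>p + \<alpha>m \<notin> \<nat>"
  proof -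
    note s = singular[OF that[THEN conjunct1] that[THEN conjunct2]]
    then have "((\<lambda>x. g x / (1 / x powr ?\<alpha>)) \<longlongrightarrow> ?C1) (at_right 0)"
      by (simp add: mult.commute)
    then have "g \<sim>[at_right 0] (\<lambda>x. ?C1 * (1 / x powr ?\<alpha>))"
      using s by (intro asymp_equivI'_const) auto
    with s show ?thesis by simp
  qed

  have part3: "(\<exists>M. slowly_varying_at_0 M \<and>
            filterlim M (if even \<lfloor>\<alpha>m\<rfloor> then at_top else at_bot) (at 0) \<and> g \<sim>[at 0] M) \<and>
       ((\<lambda>x. g x - g (- x)) \<longlongrightarrow> lp powr \<alpha>p * lm powr \<alpha>m / 2 *
                   ((-1) ^ (N + 1) * cos (\<alpha>p * pi) + cos (\<alpha>m * pi))) (at_right 0)"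
    if "\<alpha>p \<notin> \<nat> \<and> \<alpha>p + \<alpha>m \<in> \<nat>"
  proof
    note c = critical[OF that[THEN conjunct1] that[THEN conjunct2]]
    have eq: "\<alpha>p + \<alpha>m = real N + 1" using that N_Nats by simp
    then have p: "\<alpha>p = real (Suc N) - \<alpha>m" and m: "\<alpha>m = real (Suc N) - \<alpha>p" by auto
    have p_Ints: "\<alpha>p \<notin> \<int>" using that ints pos by blast
    have m_Ints: "\<alpha>m \<notin> \<int>"
    proof
      assume "\<alpha>m \<in> \<int>"
      then have "\<alpha>p \<in> \<int>" unfolding p by (rule Ints_diff[rotated]) simp
      with p_Ints show False by simp
    qed
    let ?M = "\<lambda>x. K * ln (1 / \<bar>x\<bar>)"
    have "((\<lambda>x. g x / ln (1 / \<bar>x\<bar>)) \<longlongrightarrow> K) (at_right 0)"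
      using c by (elim conjE Lim_transform_eventually) (use ev_pos in \<open>eventually_elim, simp\<close>)
    moreover have "((\<lambda>x. g (- x) / ln (1 / \<bar>- x\<bar>)) \<longlongrightarrow> K) (at_right 0)"
      using c by (elim conjE) (erule Lim_transform_eventually[of "\<lambda>x. g (- x) / ln (1 / x)"],
        use ev_pos in \<open>eventually_elim, simp\<close>)
    ultimately have "((\<lambda>x. g x / ln (1 / \<bar>x\<bar>)) \<longlongrightarrow> K) (at 0)"
      by (intro filterlim_split_at) (simp_all add: filterlim_at_left_to_right)
    then have "g \<sim>[at 0] ?M"
      using c by (intro asymp_equivI'_const) auto
    moreover have "slowly_varying_at_0 ?M" using c by (intro slowly_varying_ln) auto
    \<comment> \<open>The logarithm tends to plus infinity, so the sign of \<open>K\<close>, which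
      is that of sin (pi \<alpha>m), fixes the direction.\<close>
    moreover have "filterlim ?M (if even \<lfloor>\<alpha>m\<rfloor> then at_top else at_bot) (at 0)"
    proof (cases "even \<lfloor>\<alpha>m\<rfloor>")
      case True
      then have "0 < K" using sin_pi_sign[OF m_Ints] A by (simp add: K_def)
      then show ?thesis using True
        by (simp add: filterlim_tendsto_pos_mult_at_top[OF tendsto_const _ filterlim_ln_inverse_abs])
    next
      case False
      then have "K < 0" using sin_pi_sign[OF m_Ints] A by (simp add: K_def divide_less_0_iff mult_less_0_iff)
      then show ?thesis using False
        by (simp add: filterlim_tendsto_neg_mult_at_bot[OF tendsto_const _ filterlim_ln_inverse_abs])
    qed
    ultimately show "\<exists>M. slowly_varying_at_0 M \<and>
            filterlim M (if even \<lfloor>\<alpha>m\<rfloor> then at_top else at_bot) (at 0) \<and> g \<sim>[at 0] M"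
      by blast
    have "(bg_jump N \<alpha>p lp \<alpha>m lm \<longlongrightarrow> A * cos (pi * \<alpha>m)) (at_right 0)"
      unfolding A_def using pos eq p_Ints by (intro bg_jump_critical) auto
    \<comment> \<open>Since \<alpha>p + \<alpha>m = N + 1, the two cosine terms of C2 are equal, and
      half their sum is cos (pi \<alpha>m).\<close>
    moreover have "A * cos (pi * \<alpha>m) = lp powr \<alpha>p * lm powr \<alpha>m / 2 *
                   ((-1) ^ (N + 1) * cos (\<alpha>p * pi) + cos (\<alpha>m * pi))"
    proof -
      have "cos (pi * \<alpha>m) = (-1) ^ (N + 1) * cos (pi * \<alpha>p)"
        unfolding m by (simp only: right_diff_distrib cos_diff mult.commute[of pi "real _"] sin_npi cos_npi) simp
      then show ?thesis by (simp add: A_def mult.commute)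
    qed
    ultimately have "(bg_jump N \<alpha>p lp \<alpha>m lm \<longlongrightarrow> lp powr \<alpha>p * lm powr \<alpha>m / 2 *
                   ((-1) ^ (N + 1) * cos (\<alpha>p * pi) + cos (\<alpha>m * pi))) (at_right 0)"
      by simp
    then show "((\<lambda>x. g x - g (- x)) \<longlongrightarrow> lp powr \<alpha>p * lm powr \<alpha>m / 2 *
                   ((-1) ^ (N + 1) * cos (\<alpha>p * pi) + cos (\<alpha>m * pi))) (at_right 0)"
      by (rule Lim_transform_eventually)
        (use ev_pos in \<open>eventually_elim, simp add: g_right g_left bg_jump_def\<close>)
  qed

  show ?thesis
    using part1 part2 part3 unfolding g_def[symmetric] Let_def by blast
qed

end
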